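(* Let $T$ be a finite set, let $\mu$ be a probability measure on $E^T$ with regular conditional distributions $\mu_i(dx_i|x)$, $i\in T$, and let $C=(c_{ij})_{i,j\in T}$ be its $d$-Dobrushin interdependence matrix. Assume that $\int_{E^T} d(x_i,y_i)^2\,d\mu(x)<+\infty$ for all $i\in T$ and for some fixed $y\in E^T$. Let $r_{\mathrm{sp}}(C)$ be the spectral radius of $C$. If $r_{\mathrm{sp}}(C)<1$, then $$(1-r_{\mathrm{sp}}(C))\,\mu(f,f)\le \mathbb{E}^\mu\sum_{i\in T}\mu_i(f,f)\qquad\forall f\in L^2(E^T,\mu).$$ In particular, the spectral gap $\lambda_1(\mu)$ of $-\mathcal{L}$ in $L^2(E^T,\mu)$, where $\mathcal{L}f:=\sum_{i\in T}[\mu_i(f)-f]$, satisfies $\lambda_1(\mu)\ge 1-r_{\mathrm{sp}}(C)$.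
   Context: $(E,\mathcal{B},d)$ is either a complete separable metric space with its Borel $\sigma$-field $\mathcal{B}$, or a measurable space $(E,\mathcal{B})$ with the trivial metric $d(x,y)=\mathbb{1}_{x\ne y}$, assumed $\mathcal{B}\times\mathcal{B}$-measurable. $E^T$ carries the product $\sigma$-field. For each $i\in T$, $\mu_i(dx_i|x)$ is a given regular conditional distribution under $\mu$ of $x_i$ knowing $x_{T\setminus\{i\}}$ (a probability kernel, defined for every $x\in E^T$ and depending on $x$ only through $x_{T\setminus\{i\}}$). For a function $f$ on $E^T$, $\mu_i(f)(x)$ denotes the integral of $f$ in its $i$-th variable against $\mu_i(\cdot|x)$, the other coordinates of $x$ being fixed; $\mu_i(f,g)=\mu_i(fg)-\mu_i(f)\mu_i(g)$ is the conditional covariance; $\mu(f,g)$ is the covariance of $f,g$ under $\mu$. $W_{1,d}(\nu_1,\nu_2)=\inf_\pi\iint d(x,y)\,\pi(dx,dy)$, infimum over couplings $\pi$ of $\nu_1,\nu_2$, is the $L^1$-Wasserstein distance. The $d$-Dobrushin interdependence coefficients are $$c_{ij}:=\sup\left\{\frac{W_{1,d}(\mu_i(\cdot|x),\mu_i(\cdot|y))}{d(x_j,y_j)}:\ x,y\in E^T,\ x=y\text{ off }j,\ x_j\neq y_j\right\},\quad i,j\in T$$ (so $c_{ii}=0$); these are taken to be finite, as is implicit in speaking of the spectral radius of $C$. The spectral gap $\lambda_1(\mu)$ (lowest eigenvalue above zero of $-\mathcal{L}$) is the largest $\lambda\geq 0$ such that $\lambda\mu(f,f)\le\mathbb{E}^\mu\sum_{i\in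 T}\mu_i(f,f)$ for all $f\in L^2(E^T,\mu)$. *)

theory Defs
  imports "HOL-Probability.Probability" "Jordan_Normal_Form.Spectral_Radius"
begin

section \<open>State space\<close>

text \<open>The measurable space \<open>(E, \<B>)\<close> is represented by a measure \<open>B\<close> of which only \<open>space B\<close> and
  \<open>sets B\<close> matter.\<close>

definition polish_state_space :: "'e measure \<Rightarrow> ('e \<Rightarrow> 'e \<Rightarrow> real) \<Rightarrow> bool" where
  "polish_state_space B d \<longleftrightarrow>
     Metric_space (space B) d \<and>
     Metric_space.mcomplete (space B) d \<and>
     separable_space (Metric_space.mtopology (space B) d) \<and>
     sets B = sigma_sets (space B) {U. openin (Metric_space.mtopology (space B) d) U}"

definition trivial_metric_state_space :: "'e measure \<Rightarrow> ('e \<Rightarrow> 'e \<Rightarrow> real) \<Rightarrow> bool" where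
  "trivial_metric_state_space B d \<longleftrightarrow>
     (\<forall>x\<in>space B. \<forall>y\<in>space B. d x y = (if x = y then 0 else 1)) \<and>
     (\<lambda>(x, y). d x y) \<in> borel_measurable (B \<Otimes>\<^sub>M B)"

section \<open>Conditional distributions\<close>

text \<open>The product space \<open>E\<^sup>T\<close> is \<open>Pi\<^sub>M T (\<lambda>_. B)\<close>. The following is the sub-sigma-algebra
  generated by the coordinates \<open>x\<^sub>j\<close>, \<open>j \<in> T - {i}\<close>.\<close>

definition off_site_algebra :: "'i set \<Rightarrow> 'e measure \<Rightarrow> 'i \<Rightarrow> ('i \<Rightarrow> 'e) measure" where
  "off_site_algebra T B i =
     vimage_algebra (space (Pi\<^sub>M T (\<lambda>_. B))) (\<lambda>x. restrict x (T - {i})) (Pi\<^sub>M (T - {i}) (\<lambda>_. B))"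

definition regular_site_conditional ::
  "'i set \<Rightarrow> 'e measure \<Rightarrow> ('i \<Rightarrow> 'e) measure \<Rightarrow> 'i \<Rightarrow> (('i \<Rightarrow> 'e) \<Rightarrow> 'e measure) \<Rightarrow> bool" where
  "regular_site_conditional T B \<mu> i k \<longleftrightarrow>
     k \<in> Pi\<^sub>M T (\<lambda>_. B) \<rightarrow>\<^sub>M prob_algebra B \<and>
     (\<forall>x\<in>space (Pi\<^sub>M T (\<lambda>_. B)). \<forall>y\<in>space (Pi\<^sub>M T (\<lambda>_. B)).
        (\<forall>j\<in>T - {i}. x j = y j) \<longrightarrow> k x = k y) \<and>
     (\<forall>A\<in>sets B. AE x in \<mu>. measure (k x) A =
        real_cond_exp \<mu> (off_site_algebra T B i) (indicator {y \<in> space \<mu>. y i \<in> A}) x)"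

definition cond_mean ::
  "('i \<Rightarrow> ('i \<Rightarrow> 'e) \<Rightarrow> 'e measure) \<Rightarrow> 'i \<Rightarrow> (('i \<Rightarrow> 'e) \<Rightarrow> real) \<Rightarrow> ('i \<Rightarrow> 'e) \<Rightarrow> real" where
  "cond_mean K i f x = (\<integral>z. f (x(i := z)) \<partial>K i x)"

definition cond_covariance ::
  "('i \<Rightarrow> ('i \<Rightarrow> 'e) \<Rightarrow> 'e measure) \<Rightarrow> 'i \<Rightarrow> (('i \<Rightarrow> 'e) \<Rightarrow> real) \<Rightarrow> (('i \<Rightarrow> 'e) \<Rightarrow> real) \<Rightarrow>
    ('i \<Rightarrow> 'e) \<Rightarrow> real" where
  "cond_covariance K i f g x =
     cond_mean K i (\<lambda>y. f y * g y) x - cond_mean K i f x * cond_mean K i g x"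

definition covariance :: "'a measure \<Rightarrow> ('a \<Rightarrow> real) \<Rightarrow> ('a \<Rightarrow> real) \<Rightarrow> real" where
  "covariance \<mu> f g = (\<integral>x. f x * g x \<partial>\<mu>) - (\<integral>x. f x \<partial>\<mu>) * (\<integral>x. g x \<partial>\<mu>)"

definition square_integrable :: "'a measure \<Rightarrow> ('a \<Rightarrow> real) set" where
  "square_integrable \<mu> = {f \<in> borel_measurable \<mu>. integrable \<mu> (\<lambda>x. (f x)\<^sup>2)}"

section \<open>Wasserstein distance and interdependence matrix\<close>

definition couplings :: "'e measure \<Rightarrow> 'e measure \<Rightarrow> 'e measure \<Rightarrow> ('e \<times> 'e) measure set" where
  "couplings B \<nu>1 \<nu>2 =
     {\<pi>. sets \<pi> = sets (B \<Otimes>\<^sub>M B) \<and> distr \<pi> B fst = \<nu>1 \<and> distr \<pi> B snd = \<nu>2}"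

definition wasserstein1 ::
  "'e measure \<Rightarrow> ('e \<Rightarrow> 'e \<Rightarrow> real) \<Rightarrow> 'e measure \<Rightarrow> 'e measure \<Rightarrow> ennreal" where
  "wasserstein1 B d \<nu>1 \<nu>2 =
     (INF \<pi>\<in>couplings B \<nu>1 \<nu>2. \<integral>\<^sup>+(x, y). ennreal (d x y) \<partial>\<pi>)"

text \<open>The supremum is taken in \<open>[0, \<infinity>]\<close>, so that it is \<open>0\<close> if there is no admissible pair
  \<open>(x, y)\<close>.\<close>

definition dobrushin_coeff ::
  "'i set \<Rightarrow> 'e measure \<Rightarrow> ('e \<Rightarrow> 'e \<Rightarrow> real) \<Rightarrow> ('i \<Rightarrow> ('i \<Rightarrow> 'e) \<Rightarrow> 'e measure) \<Rightarrow>
    'i \<Rightarrow> 'i \<Rightarrow> ennreal" where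
  "dobrushin_coeff T B d K i j =
     Sup {wasserstein1 B d (K i x) (K i y) / ennreal (d (x j) (y j)) | x y.
       x \<in> space (Pi\<^sub>M T (\<lambda>_. B)) \<and> y \<in> space (Pi\<^sub>M T (\<lambda>_. B)) \<and>
       (\<forall>k\<in>T - {j}. x k = y k) \<and> x j \<noteq> y j}"

text \<open>Spectral radius of a real matrix indexed by a finite set \<open>T\<close>, obtained from the library
  notion by enumerating \<open>T\<close>. By \<open>spectral_radius_on_eq_eigenvalues\<close> the value does not depend on
  the enumeration.\<close>

definition spectral_radius_on :: "'i set \<Rightarrow> ('i \<Rightarrow> 'i \<Rightarrow> real) \<Rightarrow> real" where
  "spectral_radius_on T C =
     spectral_radius (mat (card T) (card T)
       (\<lambda>(a, b). complex_of_real (C (from_nat_into T a) (from_nat_into T b))))"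

lemma spectral_radius_on_eq_eigenvalues:
  assumes T: "finite T"
  shows "spectral_radius_on T C =
    Max (cmod ` {z. \<exists>v. (\<exists>i\<in>T. v i \<noteq> 0) \<and>
      (\<forall>i\<in>T. (\<Sum>j\<in>T. complex_of_real (C i j) * v j) = z * v i)})"
proof -
  let ?n = "card T" and ?e = "from_nat_into T"
  let ?A = "mat ?n ?n (\<lambda>(a, b). complex_of_real (C (?e a) (?e b)))"
  have bij: "bij_betw ?e {..<?n} T" using bij_betw_from_nat_into_finite[OF T] .
  have sum: "(\<Sum>b = 0..<?n. h (?e b)) = (\<Sum>j\<in>T. h j)" for h :: "'a \<Rightarrow> complex"
    using sum.reindex_bij_betw[OF bij, of h] by (simp add: atLeast0LessThan)
  have eT: "?e a \<in> T" if "a < ?n" for a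
    using bij that by (auto simp: bij_betw_def)
  have surj: "\<exists>a<?n. i = ?e a" if "i \<in> T" for i
    using bij that by (auto simp: bij_betw_def image_iff)
  have "eigenvalue ?A z \<longleftrightarrow> (\<exists>v. (\<exists>i\<in>T. v i \<noteq> 0) \<and>
      (\<forall>i\<in>T. (\<Sum>j\<in>T. complex_of_real (C i j) * v j) = z * v i))" for z
  proof
    assume "eigenvalue ?A z"
    then obtain w where w: "w \<in> carrier_vec ?n" "w \<noteq> 0\<^sub>v ?n" "?A *\<^sub>v w = z \<cdot>\<^sub>v w"
      by (auto simp: eigenvalue_def eigenvector_def)
    define v where "v i = w $ (the_inv_into {..<?n} ?e i)" for i
    have v: "v (?e a) = w $ a" if "a < ?n" for a
      using the_inv_into_f_f[OF bij_betw_imp_inj_on[OF bij], of a] that by (simp add: v_def)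
    have "\<exists>i\<in>T. v i \<noteq> 0"
    proof (rule ccontr)
      assume "\<not> (\<exists>i\<in>T. v i \<noteq> 0)"
      then have "w $ a = 0" if "a < ?n" for a using v[OF that] eT[OF that] by auto
      then show False using w(1,2) by (auto intro!: eq_vecI)
    qed
    moreover have "(\<Sum>j\<in>T. complex_of_real (C i j) * v j) = z * v i" if i: "i \<in> T" for i
    proof -
      obtain a where a: "a < ?n" "i = ?e a" using surj[OF i] by auto
      have "(?A *\<^sub>v w) $ a = (\<Sum>b = 0..<?n. complex_of_real (C (?e a) (?e b)) * v (?e b))"
        using a w(1) v by (auto simp: scalar_prod_def intro!: sum.cong)
      also have "\<dots> = (\<Sum>j\<in>T. complex_of_real (C i j) * v j)" unfolding a(2) by (rule sum)
      finally show ?thesis using w a v by simp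
    qed
    ultimately show "\<exists>v. (\<exists>i\<in>T. v i \<noteq> 0) \<and>
      (\<forall>i\<in>T. (\<Sum>j\<in>T. complex_of_real (C i j) * v j) = z * v i)" by blast
  next
    assume "\<exists>v. (\<exists>i\<in>T. v i \<noteq> 0) \<and>
      (\<forall>i\<in>T. (\<Sum>j\<in>T. complex_of_real (C i j) * v j) = z * v i)"
    then obtain v where v: "\<exists>i\<in>T. v i \<noteq> 0"
      "\<And>i. i \<in> T \<Longrightarrow> (\<Sum>j\<in>T. complex_of_real (C i j) * v j) = z * v i" by blast
    define w where "w = vec ?n (\<lambda>a. v (?e a))"
    have "w \<noteq> 0\<^sub>v ?n"
    proof
      assume "w = 0\<^sub>v ?n"
      then have "w $ a = 0" if "a < ?n" for a using that by simp
      then show False using v(1) surj by (auto simp: w_def)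
    qed
    moreover have "?A *\<^sub>v w = z \<cdot>\<^sub>v w"
    proof (rule eq_vecI)
      fix a assume "a < dim_vec (z \<cdot>\<^sub>v w)"
      then have a: "a < ?n" by (simp add: w_def)
      have "(?A *\<^sub>v w) $ a = (\<Sum>b = 0..<?n. complex_of_real (C (?e a) (?e b)) * v (?e b))"
        using a by (auto simp: scalar_prod_def w_def intro!: sum.cong)
      also have "\<dots> = z * v (?e a)" 
        using sum[of "\<lambda>j. complex_of_real (C (?e a) j) * v j"] v(2)[OF eT[OF a]] by simp
      finally show "(?A *\<^sub>v w) $ a = (z \<cdot>\<^sub>v w) $ a" using a by (simp add: w_def)
    qed (simp add: w_def)
    ultimately show "eigenvalue ?A z"
      by (auto simp: eigenvalue_def eigenvector_def w_def intro!: exI[of _ w])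
  qed
  then have "spectrum ?A = {z. \<exists>v. (\<exists>i\<in>T. v i \<noteq> 0) \<and>
      (\<forall>i\<in>T. (\<Sum>j\<in>T. complex_of_real (C i j) * v j) = z * v i)}"
    unfolding spectrum_def by blast
  then show ?thesis unfolding spectral_radius_on_def spectral_radius_def by (rule arg_cong)
qed

section \<open>Dirichlet form, generator and spectral gap\<close>

definition dirichlet_form ::
  "'i set \<Rightarrow> ('i \<Rightarrow> 'e) measure \<Rightarrow> ('i \<Rightarrow> ('i \<Rightarrow> 'e) \<Rightarrow> 'e measure) \<Rightarrow> (('i \<Rightarrow> 'e) \<Rightarrow> real) \<Rightarrow> real"
  where
  "dirichlet_form T \<mu> K f = (\<integral>x. (\<Sum>i\<in>T. cond_covariance K i f f x) \<partial>\<mu>)"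

definition generator ::
  "'i set \<Rightarrow> ('i \<Rightarrow> ('i \<Rightarrow> 'e) \<Rightarrow> 'e measure) \<Rightarrow> (('i \<Rightarrow> 'e) \<Rightarrow> real) \<Rightarrow> ('i \<Rightarrow> 'e) \<Rightarrow> real" where
  "generator T K f x = (\<Sum>i\<in>T. cond_mean K i f x - f x)"

text \<open>The spectral gap is the largest admissible constant in the Poincare inequality for the
  Dirichlet form \<open>\<langle>- L f, f\<rangle>\<close> of the generator (see \<open>dirichlet_form_eq_generator\<close> below). It is
  an extended real because every constant is admissible if \<open>\<mu>\<close> is a point mass.\<close>

definition spectral_gap ::
  "'i set \<Rightarrow> ('i \<Rightarrow> 'e) measure \<Rightarrow> ('i \<Rightarrow> ('i \<Rightarrow> 'e) \<Rightarrow> 'e measure) \<Rightarrow> ereal" where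
  "spectral_gap T \<mu> K =
     Sup {ereal l | l. 0 \<le> l \<and>
       (\<forall>f\<in>square_integrable \<mu>. l * covariance \<mu> f f \<le> dirichlet_form T \<mu> K f)}"

lemma measurable_site_update:
  assumes "i \<in> T"
  shows "(\<lambda>(x, z). x(i := z)) \<in> Pi\<^sub>M T (\<lambda>_. B) \<Otimes>\<^sub>M B \<rightarrow>\<^sub>M Pi\<^sub>M T (\<lambda>_. B)"
proof -
  have "insert i T = T" using assms by auto
  then show ?thesis
    using measurable_fun_upd[of "insert i T" T i fst "Pi\<^sub>M T (\<lambda>_. B) \<Otimes>\<^sub>M B" "\<lambda>_. B" snd]
    by (simp add: case_prod_beta' insert_absorb[OF assms])
qed

lemma site_resampling_invariant:
  fixes T :: "'i set" and B :: "'e measure"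
  assumes T: "finite T" "i \<in> T"
    and mu: "prob_space \<mu>" "sets \<mu> = sets (Pi\<^sub>M T (\<lambda>_. B))"
    and k: "regular_site_conditional T B \<mu> i k"
  shows "\<mu> = \<mu> \<bind> (\<lambda>x. distr (k x) (Pi\<^sub>M T (\<lambda>_. B)) (\<lambda>z. x(i := z)))"
    and "(\<lambda>x. distr (k x) (Pi\<^sub>M T (\<lambda>_. B)) (\<lambda>z. x(i := z)))
           \<in> \<mu> \<rightarrow>\<^sub>M prob_algebra (Pi\<^sub>M T (\<lambda>_. B))"
proof -
  let ?P = "Pi\<^sub>M T (\<lambda>_. B)" and ?F = "off_site_algebra T B i"
  define N where "N = (\<lambda>x. distr (k x) ?P (\<lambda>z. x(i := z)))"
  interpret prob_space \<mu> by fact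
  note sets_mu [measurable_cong] = mu(2)
  have sp: "space \<mu> = space ?P" using sets_eq_imp_space_eq[OF mu(2)] .
  have kP: "k \<in> ?P \<rightarrow>\<^sub>M prob_algebra B"
    and kc: "\<And>A. A \<in> sets B \<Longrightarrow> AE x in \<mu>. measure (k x) A =
        real_cond_exp \<mu> ?F (indicator {y \<in> space \<mu>. y i \<in> A}) x"
    using k by (auto simp: regular_site_conditional_def)
  have k': "k \<in> \<mu> \<rightarrow>\<^sub>M prob_algebra B" using kP mu(2) by (simp cong: measurable_cong_sets)
  have up: "(\<lambda>(x, z). x(i := z)) \<in> \<mu> \<Otimes>\<^sub>M B \<rightarrow>\<^sub>M ?P"
    using measurable_site_update[OF T(2), of B] by (simp cong: measurable_cong_sets add: mu(2))
  have N: "N \<in> \<mu> \<rightarrow>\<^sub>M prob_algebra ?P"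
    unfolding N_def by (rule measurable_distr_prob_space2[OF k' up])
  then show "(\<lambda>x. distr (k x) ?P (\<lambda>z. x(i := z))) \<in> \<mu> \<rightarrow>\<^sub>M prob_algebra ?P"
    by (simp add: N_def)
  have muin: "\<mu> \<in> space (prob_algebra ?P)"
    by (simp add: space_prob_algebra mu prob_space_axioms)
  have N2: "N \<in> ?P \<rightarrow>\<^sub>M prob_algebra ?P" using N by (simp cong: measurable_cong_sets add: mu(2))
  have sub: "subalgebra \<mu> ?F"
  proof -
    have "(\<lambda>x. restrict x (T - {i})) \<in> \<mu> \<rightarrow>\<^sub>M Pi\<^sub>M (T - {i}) (\<lambda>_. B)"
      using measurable_restrict_subset[of "T - {i}" T "\<lambda>_. B"] by (simp cong: measurable_cong_sets add: mu(2))
    then show ?thesis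
      unfolding subalgebra_def off_site_algebra_def
      by (auto simp: sp sets_vimage_algebra2 measurable_def)
  qed
  interpret finite_measure_subalgebra \<mu> ?F by unfold_locales (rule sub)
  have "\<mu> = \<mu> \<bind> N"
  proof (rule measure_eqI_PiM_finite[OF T(1)])
    show "sets \<mu> = sets ?P" by fact
    show "sets (\<mu> \<bind> N) = sets ?P" by (rule sets_bind'[OF muin N2])
    show "range (\<lambda>_. space ?P) \<subseteq> prod_algebra T (\<lambda>_. B)"
      using prod_algebraI_finite[OF T(1), of "\<lambda>_. space B" "\<lambda>_. B"]
      by (auto simp: space_PiM)
    show "(\<Union>n::nat. space ?P) = space ?P" by simp
    show "emeasure \<mu> (space ?P) \<noteq> \<infinity>" by simp
  next
    fix A :: "'i \<Rightarrow> 'e set" assume A: "\<And>j. j \<in> T \<Longrightarrow> A j \<in> sets B"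
    define R where "R = {x \<in> space \<mu>. \<forall>j\<in>T - {i}. x j \<in> A j}"
    have RF: "R \<in> sets ?F"
    proof -
      have "R = (\<lambda>x. restrict x (T - {i})) -` Pi\<^sub>E (T - {i}) A \<inter> space ?P"
        unfolding R_def sp vimage_def restrict_PiE_iff by blast
      then show ?thesis unfolding off_site_algebra_def
        using A T(1) by (auto intro!: in_vimage_algebra sets_PiM_I_finite)
    qed
    then have R[measurable]: "R \<in> sets \<mu>" using sub by (auto simp: subalgebra_def)
    have Ai: "A i \<in> sets B" using A T(2) by auto
    have I: "{y \<in> space \<mu>. y i \<in> A i} \<in> sets \<mu>"
      unfolding sp mu(2) using T(2) Ai by measurable
    have EQ: "Pi\<^sub>E T A = R \<inter> {y \<in> space \<mu>. y i \<in> A i}"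
    proof -
      have "A j \<subseteq> space B" if "j \<in> T" for j using A[OF that] sets.sets_into_space by auto
      then have "Pi\<^sub>E T A \<subseteq> space \<mu>" unfolding sp space_PiM by (intro PiE_mono)
      moreover have "x \<in> Pi\<^sub>E T A \<longleftrightarrow> (\<forall>j\<in>T. x j \<in> A j)" if "x \<in> space \<mu>" for x
        using that by (auto simp: sp space_PiM PiE_iff)
      ultimately show ?thesis using T(2) unfolding R_def by blast
    qed
    have box: "Pi\<^sub>E T A \<in> sets ?P" using A T(1) by (intro sets_PiM_I_finite) auto
    have mk: "(\<lambda>x. measure (k x) (A i)) \<in> borel_measurable \<mu>"
      using measurable_compose[OF measurable_prob_algebraD[OF k'] measurable_measure_subprob_algebra[OF Ai]] .
    have pk: "prob_space (k x)" "sets (k x) = sets B" if "x \<in> space \<mu>" for x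
      using measurable_space[OF k' that] by (auto simp: space_prob_algebra)
    have "emeasure (\<mu> \<bind> N) (Pi\<^sub>E T A) = (\<integral>\<^sup>+x. emeasure (N x) (Pi\<^sub>E T A) \<partial>\<mu>)"
      by (rule emeasure_bind_prob_algebra[OF muin N2 box])
    also have "\<dots> = (\<integral>\<^sup>+x. ennreal (indicator R x * measure (k x) (A i)) \<partial>\<mu>)"
    proof (rule nn_integral_cong)
      fix x assume x: "x \<in> space \<mu>"
      interpret kx: prob_space "k x" using pk[OF x] by simp
      have spk: "space (k x) = space B" using pk(2)[OF x] by (rule sets_eq_imp_space_eq)
      have m: "(\<lambda>z. x(i := z)) \<in> k x \<rightarrow>\<^sub>M ?P"
        using measurable_compose[OF measurable_Pair1'[OF x] up] pk(2)[OF x]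
        by (simp cong: measurable_cong_sets)
      have "emeasure (N x) (Pi\<^sub>E T A) = emeasure (k x) ((\<lambda>z. x(i := z)) -` Pi\<^sub>E T A \<inter> space (k x))"
        unfolding N_def by (rule emeasure_distr[OF m box])
      also have "(\<lambda>z. x(i := z)) -` Pi\<^sub>E T A \<inter> space (k x) = (if x \<in> R then A i else {})"
      proof -
        have xs: "x \<in> extensional T" using x by (auto simp: sp space_PiM PiE_iff)
        have "x(i := z) \<in> Pi\<^sub>E T A \<longleftrightarrow> (\<forall>j\<in>T - {i}. x j \<in> A j) \<and> z \<in> A i" for z
        proof
          assume *: "x(i := z) \<in> Pi\<^sub>E T A"
          have "x j \<in> A j" if "j \<in> T - {i}" for j using PiE_mem[OF *, of j] that by simp
          moreover have "z \<in> A i" using PiE_mem[OF * T(2)] by simp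
          ultimately show "(\<forall>j\<in>T - {i}. x j \<in> A j) \<and> z \<in> A i" by blast
        next
          assume *: "(\<forall>j\<in>T - {i}. x j \<in> A j) \<and> z \<in> A i"
          show "x(i := z) \<in> Pi\<^sub>E T A"
          proof (rule PiE_I)
            fix j assume "j \<in> T"
            then show "(x(i := z)) j \<in> A j" using * by (cases "j = i") auto
          next
            fix j assume "j \<notin> T"
            then have "j \<noteq> i" "x j = undefined" using T(2) xs by (auto simp: extensional_def)
            then show "(x(i := z)) j = undefined" by simp
          qed
        qed
        then show ?thesis using x sets.sets_into_space[OF Ai] by (auto simp: R_def spk)
      qed
      finally show "emeasure (N x) (Pi\<^sub>E T A) = ennreal (indicator R x * measure (k x) (A i))"
        by (auto simp: kx.emeasure_eq_measure)
    qed
    also have "\<dots> = ennreal (\<integral>x. indicator R x * measure (k x) (A i) \<partial>\<mu>)"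
    proof (rule nn_integral_eq_integral)
      show "integrable \<mu> (\<lambda>x. indicator R x * measure (k x) (A i))"
        by (rule integrable_const_bound[where B = 1])
           (use mk pk in \<open>auto simp: indicator_def intro!: prob_space.prob_le_1\<close>)
    qed auto
    also have "(\<integral>x. indicator R x * measure (k x) (A i) \<partial>\<mu>) =
        (\<integral>x. indicator R x * real_cond_exp \<mu> ?F (indicator {y \<in> space \<mu>. y i \<in> A i}) x \<partial>\<mu>)"
      using kc[OF Ai] mk by (intro integral_cong_AE) auto
    also have "\<dots> = (\<integral>x. indicator R x * indicator {y \<in> space \<mu>. y i \<in> A i} x \<partial>\<mu>)"
    proof (rule real_cond_exp_intg(2))
      show "integrable \<mu> (\<lambda>x. indicator R x * indicator {y \<in> space \<mu>. y i \<in> A i} x :: real)"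
        by (rule integrable_const_bound[where B = 1]) (use I in \<open>auto simp: indicator_def\<close>)
    qed (use RF I in auto)
    also have "\<dots> = measure \<mu> (Pi\<^sub>E T A)"
      unfolding EQ using I by (simp add: indicator_inter_arith[symmetric] sets.Int)
    finally show "emeasure \<mu> (Pi\<^sub>E T A) = emeasure (\<mu> \<bind> N) (Pi\<^sub>E T A)"
      by (simp add: emeasure_eq_measure)
  qed
  then show "\<mu> = \<mu> \<bind> (\<lambda>x. distr (k x) ?P (\<lambda>z. x(i := z)))" by (simp add: N_def)
qed

lemma cond_mean_integral:
  fixes T :: "'i set" and B :: "'e measure" and g :: "('i \<Rightarrow> 'e) \<Rightarrow> real"
  assumes T: "finite T" "i \<in> T"
    and mu: "prob_space \<mu>" "sets \<mu> = sets (Pi\<^sub>M T (\<lambda>_. B))"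
    and K: "regular_site_conditional T B \<mu> i (K i)"
    and g: "integrable \<mu> g"
  shows "AE x in \<mu>. integrable (K i x) (\<lambda>z. g (x(i := z)))"
    and "integrable \<mu> (cond_mean K i g)"
    and "(\<integral>x. cond_mean K i g x \<partial>\<mu>) = (\<integral>x. g x \<partial>\<mu>)"
proof -
  let ?P = "Pi\<^sub>M T (\<lambda>_. B)"
  let ?N = "\<lambda>x. distr (K i x) ?P (\<lambda>z. x(i := z))"
  have muN: "\<mu> = \<mu> \<bind> ?N" and N: "?N \<in> \<mu> \<rightarrow>\<^sub>M prob_algebra ?P"
    using site_resampling_invariant[OF T mu K] .
  have K': "K i \<in> \<mu> \<rightarrow>\<^sub>M prob_algebra B"
    using K mu(2) by (simp add: regular_site_conditional_def cong: measurable_cong_sets)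
  have setsK: "sets (K i x) = sets B" if "x \<in> space \<mu>" for x
    using measurable_space[OF K' that] by (simp add: space_prob_algebra)
  have up: "(\<lambda>(x, z). x(i := z)) \<in> \<mu> \<Otimes>\<^sub>M B \<rightarrow>\<^sub>M ?P"
    using measurable_site_update[OF T(2), of B] by (simp cong: measurable_cong_sets add: mu(2))
  have m: "(\<lambda>z. x(i := z)) \<in> K i x \<rightarrow>\<^sub>M ?P" if "x \<in> space \<mu>" for x
    using measurable_compose[OF measurable_Pair1'[OF that] up] setsK[OF that]
    by (simp cong: measurable_cong_sets)
  have resample: "(\<integral>\<^sup>+x. (\<integral>\<^sup>+z. h (x(i := z)) \<partial>K i x) \<partial>\<mu>) = (\<integral>\<^sup>+x. h x \<partial>\<mu>)"
    if h: "h \<in> borel_measurable \<mu>" for h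
  proof -
    have h': "h \<in> borel_measurable ?P" using h by (simp cong: measurable_cong_sets add: mu(2))
    have "(\<integral>\<^sup>+x. h x \<partial>\<mu>) = (\<integral>\<^sup>+x. h x \<partial>(\<mu> \<bind> ?N))" using muN by simp
    also have "\<dots> = (\<integral>\<^sup>+x. (\<integral>\<^sup>+y. h y \<partial>?N x) \<partial>\<mu>)"
      by (rule nn_integral_bind[OF h' measurable_prob_algebraD[OF N]])
    also have "\<dots> = (\<integral>\<^sup>+x. (\<integral>\<^sup>+z. h (x(i := z)) \<partial>K i x) \<partial>\<mu>)"
      by (intro nn_integral_cong nn_integral_distr m) (use h' in simp_all)
    finally show ?thesis ..
  qed
  have sect: "(\<lambda>x. \<integral>\<^sup>+z. h (x(i := z)) \<partial>K i x) \<in> borel_measurable \<mu>"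
    if h: "h \<in> borel_measurable \<mu>" for h :: "('i \<Rightarrow> 'e) \<Rightarrow> ennreal"
  proof -
    have h': "h \<in> borel_measurable ?P" using h by (simp cong: measurable_cong_sets add: mu(2))
    show ?thesis
      using measurable_compose[OF up h']
      by (intro nn_integral_measurable_subprob_algebra2[OF _ measurable_prob_algebraD[OF K']])
         (simp add: case_prod_beta')
  qed
  have gm: "g \<in> borel_measurable \<mu>" using g by auto
  have gP: "g \<in> borel_measurable ?P" using gm by (simp cong: measurable_cong_sets add: mu(2))
  have gs: "(\<lambda>z. g (x(i := z))) \<in> borel_measurable (K i x)" if "x \<in> space \<mu>" for x
    using measurable_compose[OF m[OF that] gP] .
  define P where "P h x = (\<integral>\<^sup>+z. ennreal (h (x(i := z))) \<partial>K i x)" for h :: "('i \<Rightarrow> 'e) \<Rightarrow> real" and x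
  have P: "P h \<in> borel_measurable \<mu>" "(\<integral>\<^sup>+x. P h x \<partial>\<mu>) = (\<integral>\<^sup>+x. ennreal (h x) \<partial>\<mu>)"
    if "h \<in> borel_measurable \<mu>" for h
    unfolding P_def using sect[of "\<lambda>x. ennreal (h x)"] resample[of "\<lambda>x. ennreal (h x)"] that by auto
  have R: "AE x in \<mu>. P h x \<noteq> \<infinity>" "integrable \<mu> (\<lambda>x. enn2real (P h x))"
    "(\<integral>x. enn2real (P h x) \<partial>\<mu>) = enn2real (\<integral>\<^sup>+x. ennreal (h x) \<partial>\<mu>)"
    if h: "integrable \<mu> h" for h
  proof -
    have hm: "h \<in> borel_measurable \<mu>" using h by auto
    have fin: "(\<integral>\<^sup>+x. ennreal (h x) \<partial>\<mu>) < \<infinity>"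
    proof -
      have "(\<integral>\<^sup>+x. ennreal (h x) \<partial>\<mu>) \<le> (\<integral>\<^sup>+x. ennreal (norm (h x)) \<partial>\<mu>)"
        by (intro nn_integral_mono ennreal_leI) auto
      also have "\<dots> < \<infinity>" using h by (simp add: integrable_iff_bounded)
      finally show ?thesis .
    qed
    show ae: "AE x in \<mu>. P h x \<noteq> \<infinity>"
      using P[OF hm] fin by (intro nn_integral_PInf_AE) auto
    have eq: "(\<integral>\<^sup>+x. ennreal (enn2real (P h x)) \<partial>\<mu>) = (\<integral>\<^sup>+x. ennreal (h x) \<partial>\<mu>)"
      unfolding P(2)[OF hm, symmetric] using ae
      by (intro nn_integral_cong_AE) (auto elim!: eventually_mono simp: less_top)
    have mm: "(\<lambda>x. enn2real (P h x)) \<in> borel_measurable \<mu>" using P(1)[OF hm] by measurable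
    show "integrable \<mu> (\<lambda>x. enn2real (P h x))"
      using mm fin eq by (intro integrableI_nonneg) auto
    show "(\<integral>x. enn2real (P h x) \<partial>\<mu>) = enn2real (\<integral>\<^sup>+x. ennreal (h x) \<partial>\<mu>)"
      using mm eq by (subst integral_eq_nn_integral) auto
  qed
  have abs: "integrable \<mu> (\<lambda>x. \<bar>g x\<bar>)" and neg: "integrable \<mu> (\<lambda>x. - g x)" using g by auto
  show ae: "AE x in \<mu>. integrable (K i x) (\<lambda>z. g (x(i := z)))"
    using R(1)[OF abs] AE_space
  proof eventually_elim
    case (elim x)
    then show ?case
      using gs[of x] by (auto simp: integrable_iff_bounded P_def less_top)
  qed
  have eq: "AE x in \<mu>. cond_mean K i g x = enn2real (P g x) - enn2real (P (\<lambda>x. - g x) x)"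
    using ae by eventually_elim (simp add: cond_mean_def P_def real_lebesgue_integral_def)
  have cm: "cond_mean K i g \<in> borel_measurable \<mu>"
  proof -
    have "(\<lambda>x. \<integral>y. g y \<partial>?N x) \<in> borel_measurable \<mu>"
      using measurable_compose[OF measurable_prob_algebraD[OF N] integral_measurable_subprob_algebra[OF gP]] .
    then show ?thesis
      using m gP by (subst measurable_cong[where g = "\<lambda>x. \<integral>y. g y \<partial>?N x"])
        (auto simp: cond_mean_def integral_distr)
  qed
  have i2: "integrable \<mu> (\<lambda>x. enn2real (P g x) - enn2real (P (\<lambda>x. - g x) x))"
    using R(2)[OF g] R(2)[OF neg] by simp
  show "integrable \<mu> (cond_mean K i g)"
    using integrable_cong_AE[OF cm borel_measurable_integrable[OF i2] eq] i2 by simp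
  have "(\<integral>x. cond_mean K i g x \<partial>\<mu>) = (\<integral>x. enn2real (P g x) - enn2real (P (\<lambda>x. - g x) x) \<partial>\<mu>)"
    by (rule integral_cong_AE[OF cm borel_measurable_integrable[OF i2] eq])
  also have "\<dots> = (\<integral>x. g x \<partial>\<mu>)"
    using R(2,3)[OF g] R(2,3)[OF neg] g by (simp add: real_lebesgue_integral_def)
  finally show "(\<integral>x. cond_mean K i g x \<partial>\<mu>) = (\<integral>x. g x \<partial>\<mu>)" .
qed

lemma dirichlet_form_eq_generator:
  fixes T :: "'i set" and B :: "'e measure"
  assumes T: "finite T"
    and mu: "prob_space \<mu>" "sets \<mu> = sets (Pi\<^sub>M T (\<lambda>_. B))"
    and K: "\<And>i. i \<in> T \<Longrightarrow> regular_site_conditional T B \<mu> i (K i)"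
    and f: "f \<in> square_integrable \<mu>"
  shows "dirichlet_form T \<mu> K f = (\<integral>x. - generator T K f x * f x \<partial>\<mu>)"
proof -
  interpret prob_space \<mu> by fact
  have sp: "space \<mu> = space (Pi\<^sub>M T (\<lambda>_. B))" using sets_eq_imp_space_eq[OF mu(2)] .
  have fm: "f \<in> borel_measurable \<mu>" and f2: "integrable \<mu> (\<lambda>x. f x * f x)"
    using f by (auto simp: square_integrable_def power2_eq_square)
  have f1: "integrable \<mu> f"
    using square_integrable_imp_integrable[OF fm] f2 by (simp add: power2_eq_square)
  have site: "integrable \<mu> (cond_covariance K i f f) \<and>
      integrable \<mu> (\<lambda>x. (f x - cond_mean K i f x) * f x) \<and>
      (\<integral>x. cond_covariance K i f f x \<partial>\<mu>) = (\<integral>x. (f x - cond_mean K i f x) * f x \<partial>\<mu>)"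
    if i: "i \<in> T" for i
  proof -
    note cm = cond_mean_integral[where K = K, OF T i mu K[OF i]]
    let ?m = "cond_mean K i f" and ?q = "cond_mean K i (\<lambda>x. f x * f x)"
    have K': "K i \<in> \<mu> \<rightarrow>\<^sub>M prob_algebra B"
      using K[OF i] mu(2) by (simp add: regular_site_conditional_def cong: measurable_cong_sets)
    have pK: "prob_space (K i x)" "space (K i x) = space B" if "x \<in> space \<mu>" for x
      using measurable_space[OF K' that] sets_eq_imp_space_eq by (auto simp: space_prob_algebra)
    have mm: "?m \<in> borel_measurable \<mu>" using cm(2)[OF f1] by auto
    have "AE x in \<mu>. ?m x * ?m x \<le> ?q x"
      using cm(1)[OF f1] cm(1)[OF f2] AE_space
    proof eventually_elim
      case (elim x)
      interpret kx: prob_space "K i x" using pK elim by simp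
      have "0 \<le> kx.variance (\<lambda>z. f (x(i := z)))" by simp
      also have "\<dots> = ?q x - ?m x * ?m x"
        using elim by (subst kx.variance_eq) (auto simp: cond_mean_def power2_eq_square)
      finally show ?case by simp
    qed
    then have m2: "integrable \<mu> (\<lambda>x. ?m x * ?m x)"
      using mm by (intro Bochner_Integration.integrable_bound[OF cm(2)[OF f2]])
        (auto elim!: eventually_mono)
    have fmi: "integrable \<mu> (\<lambda>x. f x * ?m x)"
    proof (rule Bochner_Integration.integrable_bound[OF Bochner_Integration.integrable_add[OF f2 m2]])
      have "\<bar>a * b\<bar> \<le> a * a + b * b" for a b :: real
      proof -
        have "2 * \<bar>a * b\<bar> \<le> a * a + b * b"
          using sum_squares_bound[of "\<bar>a\<bar>" "\<bar>b\<bar>"] by (simp add: abs_mult power2_eq_square)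
        then show ?thesis using abs_ge_zero[of "a * b"] by linarith
      qed
      then show "AE x in \<mu>. norm (f x * ?m x) \<le> norm (f x * f x + ?m x * ?m x)"
        by (auto intro!: AE_I2 order_trans[OF _ abs_ge_self])
    qed (use fm mm in auto)
    have "(\<integral>x. f x * ?m x \<partial>\<mu>) = (\<integral>x. cond_mean K i (\<lambda>x. f x * ?m x) x \<partial>\<mu>)"
      using cm(3)[OF fmi] by simp
    also have "\<dots> = (\<integral>x. ?m x * ?m x \<partial>\<mu>)"
    proof (rule Bochner_Integration.integral_cong[OF refl])
      fix x assume x: "x \<in> space \<mu>"
      have inv: "?m (x(i := z)) = ?m x" if z: "z \<in> space (K i x)" for z
      proof -
        have zB: "z \<in> space B" using z pK(2)[OF x] by (rule back_subst[where P = "\<lambda>S. z \<in> S"])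
        have xz: "(x, z) \<in> space (Pi\<^sub>M T (\<lambda>_. B) \<Otimes>\<^sub>M B)"
          using x zB unfolding sp space_pair_measure by blast
        have u: "x(i := z) \<in> space (Pi\<^sub>M T (\<lambda>_. B))"
          using measurable_space[OF measurable_site_update[OF i] xz] by (simp only: prod.case)
        have ind: "\<forall>x\<in>space (Pi\<^sub>M T (\<lambda>_. B)). \<forall>y\<in>space (Pi\<^sub>M T (\<lambda>_. B)).
            (\<forall>j\<in>T - {i}. x j = y j) \<longrightarrow> K i x = K i y"
          using K[OF i] unfolding regular_site_conditional_def by (elim conjE)
        have "K i (x(i := z)) = K i x"
          by (rule ind[THEN bspec, OF u, THEN bspec, THEN mp]) (use x sp in auto)
        then show ?thesis by (simp add: cond_mean_def)
      qed
      have "cond_mean K i (\<lambda>x. f x * ?m x) x = (\<integral>z. f (x(i := z)) * ?m x \<partial>K i x)"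
        unfolding cond_mean_def[of K i "\<lambda>x. f x * ?m x"]
        by (intro Bochner_Integration.integral_cong) (simp_all add: inv)
      then show "cond_mean K i (\<lambda>x. f x * ?m x) x = ?m x * ?m x"
        by (simp add: cond_mean_def)
    qed
    finally have key: "(\<integral>x. f x * ?m x \<partial>\<mu>) = (\<integral>x. ?m x * ?m x \<partial>\<mu>)" .
    have cov: "cond_covariance K i f f = (\<lambda>x. ?q x - ?m x * ?m x)"
      by (simp add: fun_eq_iff cond_covariance_def)
    have fd: "(\<lambda>x. (f x - ?m x) * f x) = (\<lambda>x. f x * f x - f x * ?m x)"
      by (simp add: fun_eq_iff algebra_simps)
    show ?thesis
      unfolding cov fd using cm(2)[OF f2] m2 f2 fmi key cm(3)[OF f2] by simp
  qed
  have "dirichlet_form T \<mu> K f = (\<Sum>i\<in>T. \<integral>x. cond_covariance K i f f x \<partial>\<mu>)"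
    unfolding dirichlet_form_def using site by (intro Bochner_Integration.integral_sum) auto
  also have "\<dots> = (\<Sum>i\<in>T. \<integral>x. (f x - cond_mean K i f x) * f x \<partial>\<mu>)"
    using site by (intro sum.cong) auto
  also have "\<dots> = (\<integral>x. (\<Sum>i\<in>T. (f x - cond_mean K i f x) * f x) \<partial>\<mu>)"
    using site by (intro Bochner_Integration.integral_sum[symmetric]) auto
  also have "\<dots> = (\<integral>x. - generator T K f x * f x \<partial>\<mu>)"
    by (simp add: generator_def sum_distrib_right sum_negf[symmetric])
  finally show ?thesis .
qed

end

theory Submission
  imports Defs
begin

text \<open>Let \<open>M f = (1/n) \<Sum>\<^sub>i \<mu>\<^sub>i(f)\<close>, \<open>n = card T\<close>, be the transition operator of the random-scan Gibbs
  sampler. It is symmetric for the covariance under \<open>\<mu>\<close>, and the Dirichlet form of \<open>f\<close> is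
  \<open>n (\<mu>(f,f) - \<mu>(M f,f))\<close>. By Kantorovich duality, if \<open>f\<close> has coordinatewise Lipschitz constants
  \<open>a v\<^sub>j\<close>, where \<open>v > 0\<close> satisfies \<open>C\<^sup>T v \<le> s v\<close>, then \<open>M f\<close> has the constants \<open>\<theta> a v\<^sub>j\<close> with
  \<open>\<theta> = 1 - (1 - s)/n\<close>; such a \<open>v\<close> exists for each \<open>s\<close> above the spectral radius. Hence the variance
  of \<open>M\<^sup>k f\<close> is \<open>O(\<theta>\<^sup>2\<^sup>k)\<close>, with an unspecified constant. As \<open>k \<mapsto> Var(M\<^sup>k f)\<close> is log-convex by symmetry, its
  first ratio cannot exceed the asymptotic one, so \<open>\<mu>(M f,f) \<le> \<theta> \<mu>(f,f)\<close> without any constant. This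
  extends from bounded Lipschitz functions to L2 by density, and finally \<open>s\<close> decreases to the spectral
  radius.\<close>

section \<open>Symmetric contractions for a semi-inner product\<close>

text \<open>The coefficients control Lipschitz constants, not L2 norms. The variance is at most a
  squared Lipschitz constant times a second moment, but the variance gives no bound back on the
  Lipschitz constants. Hence the detour through all iterates, where only the exponential rate
  survives; the moment assumption makes the prefactor finite. The transpose of C appears because
  c_ij measures how the law at i reacts to a change at j: that change reaches the j-th constant of M
  f through every site i, with weight v_i c_ij. The value of \<theta> averages over the resampled
  site: resampling j erases the change, the other n - 1 sites keep it, and all reactions together
  add at most s, which gives (n - 1 + s)/n. The coefficients are suprema over all configurations, so
  the Lipschitz estimates are pointwise statements, and an integral that exists only almost
  everywhere is not enough. For bounded functions every conditional integral exists at every point,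
  and boundedness survives averaging; therefore the iteration runs on bounded functions.\<close>

locale semi_inner_product =
  fixes V :: "('a \<Rightarrow> real) set" and ip :: "('a \<Rightarrow> real) \<Rightarrow> ('a \<Rightarrow> real) \<Rightarrow> real"
  assumes closed: "f \<in> V \<Longrightarrow> g \<in> V \<Longrightarrow> (\<lambda>x. f x + c * g x) \<in> V"
    and ip_linear: "f \<in> V \<Longrightarrow> g \<in> V \<Longrightarrow> h \<in> V \<Longrightarrow> ip (\<lambda>x. f x + c * g x) h = ip f h + c * ip g h"
    and ip_sym: "f \<in> V \<Longrightarrow> g \<in> V \<Longrightarrow> ip f g = ip g f"
    and ip_nonneg: "f \<in> V \<Longrightarrow> 0 \<le> ip f f"
begin

lemma diff_closed: "f \<in> V \<Longrightarrow> g \<in> V \<Longrightarrow> (\<lambda>x. f x - g x) \<in> V"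
  using closed[of f g "-1"] by simp

lemma ip_diff_left: "f \<in> V \<Longrightarrow> g \<in> V \<Longrightarrow> h \<in> V \<Longrightarrow> ip (\<lambda>x. f x - g x) h = ip f h - ip g h"
  using ip_linear[of f g h "-1"] by simp

lemma ip_diff_right: "f \<in> V \<Longrightarrow> g \<in> V \<Longrightarrow> h \<in> V \<Longrightarrow> ip h (\<lambda>x. f x - g x) = ip h f - ip h g"
  using ip_diff_left[of f g h] diff_closed[of f g] ip_sym by simp

text \<open>The form may vanish on nonzero functions, as the covariance does on constants, so the
  usual minimizing t is not always available. If \<open>ip g g = 0\<close>, the nonnegative
  quadratic in t is affine, which forces its slope to vanish.\<close>

lemma Cauchy_Schwarz:
  assumes f: "f \<in> V" and g: "g \<in> V"
  shows "(ip f g)\<^sup>2 \<le> ip f f * ip g g"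
proof -
  have quad: "0 \<le> ip f f + 2 * t * ip f g + t\<^sup>2 * ip g g" for t
  proof -
    let ?h = "\<lambda>x. f x + t * g x"
    have h: "?h \<in> V" using closed f g .
    have "ip ?h ?h = ip f ?h + t * ip g ?h" by (rule ip_linear[OF f g h])
    also have "ip f ?h = ip f f + t * ip f g"
      using ip_linear[OF f g f, of t] ip_sym[OF f h] ip_sym[OF g f] by simp
    also have "ip g ?h = ip f g + t * ip g g"
      using ip_linear[OF f g g, of t] ip_sym[OF g h] by simp
    finally have "ip ?h ?h = ip f f + 2 * t * ip f g + t\<^sup>2 * ip g g"
      by (simp add: algebra_simps power2_eq_square)
    then show ?thesis using ip_nonneg[OF h] by simp
  qed
  show ?thesis
  proof (cases "ip g g = 0")
    case True
    have "ip f g = 0"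
    proof (rule ccontr)
      assume n: "ip f g \<noteq> 0"
      \<comment> \<open>This t gives the affine function the value -1.\<close>
      then have "2 * (- (ip f f + 1) / (2 * ip f g)) * ip f g = - (ip f f + 1)" by simp
      then show False using quad[of "- (ip f f + 1) / (2 * ip f g)"] True by simp
    qed
    then show ?thesis using True by simp
  next
    case False
    then have pos: "0 < ip g g" using ip_nonneg[OF g] by simp
    have "0 \<le> ip g g * (ip f f + 2 * (- ip f g / ip g g) * ip f g + (- ip f g / ip g g)\<^sup>2 * ip g g)"
      using quad[of "- ip f g / ip g g"] pos by (intro mult_nonneg_nonneg) auto
    also have "\<dots> = ip g g * ip f f - (ip f g)\<^sup>2"
      using pos by (simp add: field_simps power2_eq_square)
    finally show ?thesis by (simp add: mult.commute)
  qed
qed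

text \<open>By symmetry, \<open>a k = ip (A\<^sup>k f) (A\<^sup>k f)\<close> is log-convex, so its growth rate bounds the
  initial ratio \<open>a 1 / a 0\<close>.\<close>

lemma ip_image_le_of_decay:
  assumes A: "\<And>f. f \<in> V \<Longrightarrow> A f \<in> V"
    and sym: "\<And>f g. f \<in> V \<Longrightarrow> g \<in> V \<Longrightarrow> ip (A f) g = ip f (A g)"
    and \<theta>: "0 \<le> \<theta>" and f: "f \<in> V"
    and decay: "\<And>k. ip ((A ^^ k) f) ((A ^^ k) f) \<le> c * (\<theta>\<^sup>2) ^ k"
  shows "ip (A f) f \<le> \<theta> * ip f f"
proof -
  define a where "a k = ip ((A ^^ k) f) ((A ^^ k) f)" for k
  have V: "(A ^^ k) f \<in> V" for k by (induction k) (use f A in auto)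
  have a_nonneg: "0 \<le> a k" for k unfolding a_def by (rule ip_nonneg[OF V])
  have convex: "(a (Suc k))\<^sup>2 \<le> a k * a (Suc (Suc k))" for k
  proof -
    \<comment> \<open>One factor A moves to the other side by symmetry, so that Cauchy-Schwarz
      compares the iterates k and k + 2.\<close>
    have "a (Suc k) = ip ((A ^^ k) f) ((A ^^ Suc (Suc k)) f)"
      unfolding a_def using sym[OF V[of k] V[of "Suc k"]] by simp
    then show ?thesis unfolding a_def using Cauchy_Schwarz[OF V[of k] V[of "Suc (Suc k)"]] by simp
  qed
  have first: "a 1 \<le> \<theta>\<^sup>2 * a 0"
  proof (rule ccontr)
    assume "\<not> ?thesis"
    then have gt: "\<theta>\<^sup>2 * a 0 < a 1" by simp
    moreover have "0 \<le> \<theta>\<^sup>2 * a 0" using a_nonneg[of 0] by simp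
    ultimately have a1: "0 < a 1" by linarith
    have a0: "0 < a 0"
    proof (rule ccontr)
      assume "\<not> 0 < a 0"
      then have "a 0 = 0" using a_nonneg[of 0] by simp
      then show False using convex[of 0] a1 by simp
    qed
    define q where "q = a 1 / a 0"
    have q: "\<theta>\<^sup>2 < q" "0 < q" using gt a0 a1 by (auto simp: q_def field_simps)
    have grow: "0 < a k \<and> q * a k \<le> a (Suc k)" for k
    proof (induction k)
      case 0
      then show ?case using a0 by (simp add: q_def)
    next
      case (Suc k)
      then have pos: "0 < a (Suc k)" using mult_pos_pos[of q "a k"] q by linarith
      have "q * (a (Suc k))\<^sup>2 \<le> q * (a k * a (Suc (Suc k)))"
        using convex[of k] q by (intro mult_left_mono) auto
      also have "\<dots> = (q * a k) * a (Suc (Suc k))" by simp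
      also have "\<dots> \<le> a (Suc k) * a (Suc (Suc k))"
        using Suc a_nonneg by (intro mult_right_mono) auto
      finally have "a (Suc k) * (q * a (Suc k)) \<le> a (Suc k) * a (Suc (Suc k))"
        by (simp add: power2_eq_square mult_ac)
      then show ?case using pos by simp
    qed
    have lower: "q ^ k * a 0 \<le> a k" for k
    proof (induction k)
      case (Suc k)
      have "q ^ Suc k * a 0 = q * (q ^ k * a 0)" by simp
      also have "\<dots> \<le> q * a k" using Suc q by (intro mult_left_mono) auto
      also have "\<dots> \<le> a (Suc k)" using grow by simp
      finally show ?case .
    qed simp
    \<comment> \<open>Growth at rate q against decay at the smaller rate \<theta> squared: the
      unknown c is killed as k grows.\<close>
    have "a 0 \<le> c * (\<theta>\<^sup>2 / q) ^ k" for k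
    proof -
      have "q ^ k * a 0 \<le> c * (\<theta>\<^sup>2) ^ k" using lower[of k] decay[of k] by (simp add: a_def)
      then show ?thesis using q by (simp add: field_simps power_divide)
    qed
    moreover have "(\<lambda>k. c * (\<theta>\<^sup>2 / q) ^ k) \<longlonglongrightarrow> c * 0"
      using q \<theta> by (intro tendsto_mult tendsto_const LIMSEQ_realpow_zero) auto
    ultimately have "a 0 \<le> c * 0"
      by (intro LIMSEQ_le_const) auto
    then show False using a0 by simp
  qed
  have "(ip (A f) f)\<^sup>2 \<le> ip (A f) (A f) * ip f f" by (rule Cauchy_Schwarz[OF A[OF f] f])
  also have "\<dots> \<le> (\<theta>\<^sup>2 * ip f f) * ip f f"
    using first ip_nonneg[OF f] by (intro mult_right_mono) (auto simp: a_def)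
  also have "\<dots> = (\<theta> * ip f f)\<^sup>2" by (simp add: power2_eq_square)
  finally show ?thesis using \<theta> ip_nonneg[OF f] by (meson mult_nonneg_nonneg power2_le_imp_le)
qed

text \<open>Both sides are continuous quadratic forms. After expanding around f, the mixed terms
  pair the error with the fixed functions \<open>A f\<close> and f and vanish by Cauchy-Schwarz; the
  term quadratic in the error is controlled by \<open>bound\<close>.\<close>

lemma ip_image_le_of_dense:
  assumes A: "\<And>f. f \<in> V \<Longrightarrow> A f \<in> V"
    and sym: "\<And>f g. f \<in> V \<Longrightarrow> g \<in> V \<Longrightarrow> ip (A f) g = ip f (A g)"
    and bound: "\<And>f. f \<in> V \<Longrightarrow> \<bar>ip (A f) f\<bar> \<le> ip f f"
    and D: "D \<subseteq> V"
    and dense: "\<And>e. 0 < e \<Longrightarrow> \<exists>h\<in>D. ip (\<lambda>x. f x - h x) (\<lambda>x. f x - h x) < e"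
    and le: "\<And>h. h \<in> D \<Longrightarrow> ip (A h) h \<le> \<theta> * ip h h"
    and f: "f \<in> V"
  shows "ip (A f) f \<le> \<theta> * ip f f"
proof -
  have "\<forall>n. \<exists>h\<in>D. ip (\<lambda>x. f x - h x) (\<lambda>x. f x - h x) < inverse (real (Suc n))"
    using dense by (metis inverse_positive_iff_positive of_nat_0_less_iff zero_less_Suc)
  then obtain h where hD: "\<And>n. h n \<in> D"
    and h: "\<And>n. ip (\<lambda>x. f x - h n x) (\<lambda>x. f x - h n x) < inverse (real (Suc n))" by metis
  have hV: "h n \<in> V" for n using hD D by auto
  define g where "g n = (\<lambda>x. f x - h n x)" for n
  have gV: "g n \<in> V" for n unfolding g_def by (rule diff_closed[OF f hV])
  have e: "(\<lambda>n. ip (g n) (g n)) \<longlonglongrightarrow> 0"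
  proof (rule tendsto_sandwich[OF _ _ tendsto_const LIMSEQ_inverse_real_of_nat])
    show "\<forall>\<^sub>F n in sequentially. 0 \<le> ip (g n) (g n)" using ip_nonneg[OF gV] by simp
    show "\<forall>\<^sub>F n in sequentially. ip (g n) (g n) \<le> inverse (real (Suc n))"
      unfolding g_def by (intro always_eventually allI less_imp_le h)
  qed
  have small: "(\<lambda>n. ip u (g n)) \<longlonglongrightarrow> 0" if u: "u \<in> V" for u
  proof (rule Lim_null_comparison)
    show "\<forall>\<^sub>F n in sequentially. norm (ip u (g n)) \<le> sqrt (ip u u * ip (g n) (g n))"
      using Cauchy_Schwarz[OF u gV] by (intro always_eventually allI) (simp add: real_le_rsqrt)
    show "(\<lambda>n. sqrt (ip u u * ip (g n) (g n))) \<longlonglongrightarrow> 0"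
      using tendsto_real_sqrt[OF tendsto_mult[OF tendsto_const[of "ip u u"] e]] by simp
  qed
  have Ag: "(\<lambda>n. ip (A (g n)) (g n)) \<longlonglongrightarrow> 0"
    by (rule Lim_null_comparison[OF _ e]) (use bound[OF gV] in auto)
  have hg: "h n = (\<lambda>x. f x - g n x)" for n by (simp add: g_def)
  have form: "ip (A (h n)) (h n) = ip (A f) f - 2 * ip (A f) (g n) + ip (A (g n)) (g n)" for n
  proof -
    have "ip (A (h n)) (h n) = ip (h n) (A (h n))" using sym hV by blast
    also have "\<dots> = ip f (A (h n)) - ip (g n) (A (h n))"
      by (subst (1) hg) (rule ip_diff_left[OF f gV A[OF hV]])
    also have "\<dots> = ip (A f) (h n) - ip (A (g n)) (h n)" using sym f gV hV by simp
    also have "\<dots> = ip (A f) f - ip (A f) (g n) - (ip (A (g n)) f - ip (A (g n)) (g n))"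
      using ip_diff_right[OF f gV] A f gV by (subst (1 2) hg) simp
    also have "ip (A (g n)) f = ip (A f) (g n)" using sym ip_sym A f gV by metis
    finally show ?thesis by simp
  qed
  have form2: "ip (h n) (h n) = ip f f - 2 * ip f (g n) + ip (g n) (g n)" for n
    using ip_diff_left[OF f gV hV] ip_diff_right[OF f gV f] ip_diff_right[OF f gV gV] ip_sym[OF f gV]
    unfolding hg[symmetric] by simp
  have "(\<lambda>n. ip (A (h n)) (h n)) \<longlonglongrightarrow> ip (A f) f - 2 * 0 + 0"
    unfolding form by (intro tendsto_intros small Ag A f)
  moreover have "(\<lambda>n. \<theta> * ip (h n) (h n)) \<longlonglongrightarrow> \<theta> * (ip f f - 2 * 0 + 0)"
    unfolding form2 by (intro tendsto_intros small e f)
  ultimately show ?thesis using le[OF hD] by (intro LIMSEQ_le) auto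
qed

end

section \<open>Sub-invariant vectors of a nonnegative matrix\<close>

text \<open>If z is an eigenvalue of the scaled matrix, then s z is one of A. The rescaling is made
  to reach radius below 1, where the powers of a matrix are bounded.\<close>

lemma spectral_radius_scale_less_1:
  fixes A :: "complex mat"
  assumes A: "A \<in> carrier_mat n n" and n: "0 < n" and s: "spectral_radius A < s" "0 < s"
  shows "spectral_radius (complex_of_real (inverse s) \<cdot>\<^sub>m A) < 1"
proof -
  let ?c = "complex_of_real (inverse s)"
  have cA: "?c \<cdot>\<^sub>m A \<in> carrier_mat n n" using A by simp
  obtain z where z: "z \<in> spectrum (?c \<cdot>\<^sub>m A)" "spectral_radius (?c \<cdot>\<^sub>m A) = norm z"
    using spectral_radius_mem_max(1)[OF cA n] by auto
  obtain w where w: "w \<in> carrier_vec n" "w \<noteq> 0\<^sub>v n" "(?c \<cdot>\<^sub>m A) *\<^sub>v w = z \<cdot>\<^sub>v w"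
    using z(1) A by (auto simp: spectrum_def eigenvalue_def eigenvector_def)
  have "?c \<cdot>\<^sub>v (A *\<^sub>v w) = z \<cdot>\<^sub>v w"
  proof -
    have "?c \<cdot>\<^sub>v (A *\<^sub>v w) = (?c \<cdot>\<^sub>m A) *\<^sub>v w"
      using A w(1) by (intro eq_vecI) (auto simp: scalar_prod_def sum_distrib_left mult_ac)
    then show ?thesis using w by simp
  qed
  then have "of_real s \<cdot>\<^sub>v (?c \<cdot>\<^sub>v (A *\<^sub>v w)) = of_real s \<cdot>\<^sub>v (z \<cdot>\<^sub>v w)" by simp
  then have "A *\<^sub>v w = (of_real s * z) \<cdot>\<^sub>v w"
    using s by (simp add: smult_smult_assoc flip: of_real_mult)
  then have "of_real s * z \<in> spectrum A"
    using w A by (auto simp: spectrum_def eigenvalue_def eigenvector_def intro!: exI[of _ w])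
  then have "norm (of_real s * z) \<le> spectral_radius A"
    using spectral_radius_mem_max(2)[OF A n] by auto
  moreover have "norm (of_real s * z) = s * norm z" using s by (simp add: norm_mult)
  ultimately have "s * norm z < s * 1" using s(1) by linarith
  then show ?thesis using s z(2) by (simp only: mult_less_cancel_left_pos)
qed

lemma spectral_radius_on_nonneg:
  assumes "finite T" "T \<noteq> {}"
  shows "0 \<le> spectral_radius_on T C"
proof -
  have "0 < card T" using assms by (simp add: card_gt_0_iff)
  from spectral_radius_mem_max(1)[OF mat_carrier this] show ?thesis
    unfolding spectral_radius_on_def by (metis imageE norm_ge_zero)
qed

text \<open>The vector is a truncated Neumann series \<open>\<Sum>k<N. s\<^sup>-\<^sup>k (C\<^sup>T)\<^sup>k 1\<close>; it is enough to stop as soon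
  as the next term is at most \<open>1\<close>.\<close>

lemma exists_subinvariant_vector:
  fixes C :: "'i \<Rightarrow> 'i \<Rightarrow> real"
  assumes T: "finite T" "T \<noteq> {}" and C: "\<And>i j. i \<in> T \<Longrightarrow> j \<in> T \<Longrightarrow> 0 \<le> C i j"
    and s: "spectral_radius_on T C < s"
  shows "\<exists>v. (\<forall>i\<in>T. 0 < v i) \<and> (\<forall>j\<in>T. (\<Sum>i\<in>T. v i * C i j) \<le> s * v j)"
proof -
  let ?n = "card T" and ?e = "from_nat_into T"
  have n: "0 < ?n" using T by (simp add: card_gt_0_iff)
  have r0: "0 \<le> spectral_radius_on T C" by (rule spectral_radius_on_nonneg[OF T])
  \<comment> \<open>An intermediate rate: the powers of A/t stay bounded because t exceeds the
    radius, and t < s leaves room for the geometric factor \<open>(t / s) ^ k\<close>.\<close>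
  define t where "t = (spectral_radius_on T C + s) / 2"
  have t: "spectral_radius_on T C < t" "0 < t" "t < s" using s r0 by (auto simp: t_def)
  have s0: "0 < s" using t by simp
  have bij: "bij_betw ?e {..<?n} T" using bij_betw_from_nat_into_finite[OF T(1)] .
  have eT: "?e a \<in> T" if "a < ?n" for a using bij that by (auto simp: bij_betw_def)
  have sum_e: "(\<Sum>b = 0..<?n. h (?e b)) = (\<Sum>j\<in>T. h j)" for h :: "'i \<Rightarrow> complex"
    using sum.reindex_bij_betw[OF bij, of h] by (simp add: atLeast0LessThan)
  define A where "A = mat ?n ?n (\<lambda>(a, b). complex_of_real (C (?e a) (?e b)))"
  define A' where "A' = complex_of_real (inverse t) \<cdot>\<^sub>m A"
  have A: "A \<in> carrier_mat ?n ?n" and A': "A' \<in> carrier_mat ?n ?n" by (simp_all add: A_def A'_def)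
  have "spectral_radius A' < 1"
    unfolding A'_def using spectral_radius_scale_less_1[OF A n, of t] t
    by (simp add: spectral_radius_on_def A_def)
  then obtain c where c: "\<And>k. norm_bound (A' ^\<^sub>m k) c"
    using spectral_radius_jnf_norm_bound_less_1_upper_triangular[OF A'] by blast
  \<comment> \<open>\<open>u k\<close> is the k-th power of the transpose applied to the constant
    vector 1, that is, the vector of column sums of the k-th power of C.\<close>
  define u where "u = rec_nat (\<lambda>_. 1) (\<lambda>_ w j. \<Sum>i\<in>T. w i * C i j)"
  have u0: "u 0 j = 1" and uS: "u (Suc k) j = (\<Sum>i\<in>T. u k i * C i j)" for k j
    by (simp_all add: u_def)
  have u_nonneg: "j \<in> T \<Longrightarrow> 0 \<le> u k j" for k j
    by (induction k arbitrary: j) (auto simp: u0 uS intro!: sum_nonneg mult_nonneg_nonneg C)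
  have pow: "A' ^\<^sub>m k \<in> carrier_mat ?n ?n" for k using A' by simp
  have u_pow: "complex_of_real (u k (?e b)) = of_real (t ^ k) * (\<Sum>a = 0..<?n. (A' ^\<^sub>m k) $$ (a, b))"
    if b: "b < ?n" for k b
    using b
  proof (induction k arbitrary: b)
    case 0
    have "(\<Sum>a = 0..<?n. (1\<^sub>m ?n :: complex mat) $$ (a, b)) = (\<Sum>a = 0..<?n. if a = b then 1 else 0)"
      using 0 by (intro sum.cong) auto
    then show ?case using 0 A' by (simp add: u0)
  next
    case (Suc k)
    have "(\<Sum>a = 0..<?n. (A' ^\<^sub>m Suc k) $$ (a, b))
        = (\<Sum>a = 0..<?n. \<Sum>m = 0..<?n. (A' ^\<^sub>m k) $$ (a, m) * A' $$ (m, b))"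
      using pow[of k] A' Suc.prems by (intro sum.cong) (auto simp: scalar_prod_def)
    also have "\<dots> = (\<Sum>m = 0..<?n. (\<Sum>a = 0..<?n. (A' ^\<^sub>m k) $$ (a, m)) * A' $$ (m, b))"
      by (subst sum.swap) (simp add: sum_distrib_right)
    finally have "of_real (t ^ Suc k) * (\<Sum>a = 0..<?n. (A' ^\<^sub>m Suc k) $$ (a, b))
        = (\<Sum>m = 0..<?n. (of_real (t ^ k) * (\<Sum>a = 0..<?n. (A' ^\<^sub>m k) $$ (a, m))) * (of_real t * A' $$ (m, b)))"
      by (simp add: sum_distrib_left mult_ac)
    also have "\<dots> = (\<Sum>m = 0..<?n. of_real (u k (?e m) * C (?e m) (?e b)))"
      using Suc t by (intro sum.cong) (auto simp: A'_def A_def)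
    also have "\<dots> = of_real (u (Suc k) (?e b))"
      using sum_e[of "\<lambda>i. of_real (u k i * C i (?e b))"] by (simp add: uS)
    finally show ?case by simp
  qed
  have u_le: "u k j \<le> t ^ k * (real ?n * c)" if "j \<in> T" for k j
  proof -
    have "j \<in> ?e ` {..<?n}" using bij that by (simp add: bij_betw_def)
    then obtain b where b: "b < ?n" "j = ?e b" by auto
    have "u k j \<le> norm (complex_of_real (u k j))" by simp
    also have "\<dots> = t ^ k * norm (\<Sum>a = 0..<?n. (A' ^\<^sub>m k) $$ (a, b))"
      unfolding b(2) u_pow[OF b(1)] norm_mult using t by (simp add: norm_power)
    also have "norm (\<Sum>a = 0..<?n. (A' ^\<^sub>m k) $$ (a, b)) \<le> (\<Sum>a = 0..<?n. c)"
      using c[of k] carrier_matD[OF A'] b(1) unfolding norm_bound_def by (intro sum_norm_le) auto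
    finally show ?thesis using t by simp
  qed
  have "(\<lambda>k. (t / s) ^ k * (real ?n * c)) \<longlonglongrightarrow> 0 * (real ?n * c)"
    using t by (intro tendsto_mult tendsto_const LIMSEQ_realpow_zero) auto
  then have "\<forall>\<^sub>F k in sequentially. (t / s) ^ k * (real ?n * c) < 1"
    by (intro order_tendstoD) auto
  then obtain N where N: "(t / s) ^ Suc N * (real ?n * c) < 1"
    by (auto simp: eventually_sequentially intro: le_SucI)
  have uN: "u (Suc N) j / s ^ Suc N \<le> 1" if "j \<in> T" for j
  proof -
    have "u (Suc N) j \<le> s ^ Suc N * ((t / s) ^ Suc N * (real ?n * c))"
      using u_le[OF that, of "Suc N"] s0 by (simp add: power_divide)
    also have "\<dots> \<le> s ^ Suc N * 1" using N s0 by (intro mult_left_mono) auto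
    finally show ?thesis using s0 by (simp add: field_simps)
  qed
  define v where "v j = (\<Sum>k\<le>N. u k j / s ^ k)" for j
  have v_pos: "0 < v j" if "j \<in> T" for j
  proof -
    have "0 < u 0 j / s ^ 0" by (simp add: u0)
    also have "\<dots> \<le> v j" unfolding v_def
      by (rule member_le_sum) (use u_nonneg[OF that] s0 in auto)
    finally show ?thesis .
  qed
  have "(\<Sum>i\<in>T. v i * C i j) \<le> s * v j" if j: "j \<in> T" for j
  proof -
    have "(\<Sum>i\<in>T. v i * C i j) = (\<Sum>k\<le>N. u (Suc k) j / s ^ k)"
      unfolding v_def sum_distrib_right uS
      by (subst sum.swap) (simp add: sum_divide_distrib)
    also have "\<dots> = s * (\<Sum>k\<le>N. u (Suc k) j / s ^ Suc k)"
      using s0 by (simp add: sum_distrib_left)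
    \<comment> \<open>The shift loses the term k = 0, equal to 1, and gains the term k = N + 1, at
      most 1 by the choice of N. The lost term is also what makes v positive.\<close>
    also have "(\<Sum>k\<le>N. u (Suc k) j / s ^ Suc k) = (\<Sum>k\<le>Suc N. u k j / s ^ k) - 1"
      by (simp add: sum.atMost_Suc_shift u0 del: sum.atMost_Suc)
    also have "s * \<dots> \<le> s * v j"
      using s0 uN[OF j] by (intro mult_left_mono) (auto simp: v_def)
    finally show ?thesis .
  qed
  then show ?thesis using v_pos by blast
qed

section \<open>Gibbs sampling in L2\<close>

text \<open>The set of sites is nonempty here because the operator below averages over it; the empty
  case is settled separately by \<open>covariance_empty_sites\<close>.\<close>

locale gibbs_sampler = prob_space \<mu>
  for \<mu> :: "('i \<Rightarrow> 'e) measure" +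
  fixes T :: "'i set" and B :: "'e measure" and K :: "'i \<Rightarrow> ('i \<Rightarrow> 'e) \<Rightarrow> 'e measure"
  assumes finite_T: "finite T" and T_nonempty: "T \<noteq> {}"
    and sets_mu: "sets \<mu> = sets (Pi\<^sub>M T (\<lambda>_. B))"
    and K: "\<And>i. i \<in> T \<Longrightarrow> regular_site_conditional T B \<mu> i (K i)"
begin

abbreviation L2 :: "(('i \<Rightarrow> 'e) \<Rightarrow> real) set" where "L2 \<equiv> square_integrable \<mu>"

lemma space_mu: "space \<mu> = space (Pi\<^sub>M T (\<lambda>_. B))"
  using sets_eq_imp_space_eq[OF sets_mu] .

lemma L2_iff: "f \<in> L2 \<longleftrightarrow> f \<in> borel_measurable \<mu> \<and> integrable \<mu> (\<lambda>x. f x * f x)"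
  by (simp add: square_integrable_def power2_eq_square)

lemma L2_mult_integrable:
  assumes "f \<in> L2" "g \<in> L2"
  shows "integrable \<mu> (\<lambda>x. f x * g x)"
proof (rule Bochner_Integration.integrable_bound[where f = "\<lambda>x. f x * f x + g x * g x"])
  have "\<bar>a * b\<bar> \<le> a * a + b * b" for a b :: real
  proof -
    have "2 * \<bar>a * b\<bar> \<le> a * a + b * b"
      using sum_squares_bound[of "\<bar>a\<bar>" "\<bar>b\<bar>"] by (simp add: abs_mult power2_eq_square)
    then show ?thesis using abs_ge_zero[of "a * b"] by linarith
  qed
  then show "AE x in \<mu>. norm (f x * g x) \<le> norm (f x * f x + g x * g x)"
    by (auto intro!: AE_I2 order_trans[OF _ abs_ge_self])
qed (use assms in \<open>auto simp: L2_iff\<close>)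

lemma L2_integrable: "f \<in> L2 \<Longrightarrow> integrable \<mu> f"
  by (rule square_integrable_imp_integrable) (auto simp: square_integrable_def)

lemma L2_bounded:
  assumes f: "f \<in> borel_measurable \<mu>" and b: "\<And>x. x \<in> space \<mu> \<Longrightarrow> \<bar>f x\<bar> \<le> b"
  shows "f \<in> L2"
proof -
  have "f x * f x \<le> b * b" if "x \<in> space \<mu>" for x
    using power_mono[OF b[OF that], of 2] by (simp add: power2_eq_square)
  then show ?thesis unfolding L2_iff
    using f by (auto intro!: integrable_const_bound[where B = "b * b"])
qed

lemma L2_lincomb:
  assumes f: "f \<in> L2" and g: "g \<in> L2"
  shows "(\<lambda>x. f x + c * g x) \<in> L2"
proof -
  have "(\<lambda>x. (f x + c * g x) * (f x + c * g x))
      = (\<lambda>x. f x * f x + 2 * c * (f x * g x) + c * c * (g x * g x))"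
    by (simp add: fun_eq_iff algebra_simps)
  moreover have "f \<in> borel_measurable \<mu>" "g \<in> borel_measurable \<mu>" using f g by (auto simp: L2_iff)
  ultimately show ?thesis
    using L2_mult_integrable[OF f f] L2_mult_integrable[OF f g] L2_mult_integrable[OF g g]
    by (simp add: L2_iff)
qed

lemma L2_sum:
  assumes "finite S" "\<And>i. i \<in> S \<Longrightarrow> F i \<in> L2"
  shows "(\<lambda>x. \<Sum>i\<in>S. F i x) \<in> L2"
  using assms
proof (induction S)
  case empty
  show ?case using L2_bounded[of "\<lambda>_. 0" 0] by simp
next
  case (insert i S)
  then show ?case using L2_lincomb[of "F i" "\<lambda>x. \<Sum>i\<in>S. F i x" 1] by simp
qed

lemma covariance_eq_variance: "f \<in> L2 \<Longrightarrow> covariance \<mu> f f = variance f"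
  using variance_eq[OF L2_integrable, of f] by (simp add: covariance_def L2_iff power2_eq_square)

sublocale cov: semi_inner_product L2 "covariance \<mu>"
proof
  fix f g h c
  assume f: "f \<in> L2" and g: "g \<in> L2" and h: "h \<in> L2"
  have "(\<lambda>x. (f x + c * g x) * h x) = (\<lambda>x. f x * h x + c * (g x * h x))"
    by (simp add: fun_eq_iff algebra_simps)
  then show "covariance \<mu> (\<lambda>x. f x + c * g x) h = covariance \<mu> f h + c * covariance \<mu> g h"
    using L2_mult_integrable[OF f h] L2_mult_integrable[OF g h] L2_integrable[OF f] L2_integrable[OF g]
    by (simp add: covariance_def algebra_simps)
next
  fix f assume "f \<in> L2"
  then show "0 \<le> covariance \<mu> f f" by (simp only: covariance_eq_variance variance_positive)
next
  fix f g :: "('i \<Rightarrow> 'e) \<Rightarrow> real"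
  show "covariance \<mu> f g = covariance \<mu> g f" by (simp add: covariance_def mult.commute)
qed (rule L2_lincomb)

text \<open>The mean minimizes the second moment. Below, c is the value of f at the reference point
  in the Lipschitz bound, and 0 in the density argument.\<close>

lemma covariance_le_second_moment:
  assumes f: "f \<in> L2"
  shows "covariance \<mu> f f \<le> (\<integral>x. (f x - c)\<^sup>2 \<partial>\<mu>)"
proof -
  have i: "integrable \<mu> (\<lambda>x. f x * f x)" "integrable \<mu> f"
    using f L2_integrable[OF f] by (auto simp: L2_iff)
  have "(\<lambda>x. (f x - c)\<^sup>2) = (\<lambda>x. f x * f x - 2 * c * f x + c\<^sup>2)"
    by (simp add: fun_eq_iff power2_eq_square algebra_simps)
  then have "(\<integral>x. (f x - c)\<^sup>2 \<partial>\<mu>) = (\<integral>x. f x * f x \<partial>\<mu>) - 2 * c * expectation f + c\<^sup>2"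
    using i by (simp add: prob_space)
  moreover have "0 \<le> (expectation f - c)\<^sup>2" by simp
  ultimately show ?thesis by (simp add: covariance_def power2_eq_square algebra_simps)
qed

section \<open>Site kernels, and conditional means as projections of L2\<close>

lemma K_measurable: "i \<in> T \<Longrightarrow> K i \<in> Pi\<^sub>M T (\<lambda>_. B) \<rightarrow>\<^sub>M prob_algebra B"
  using K by (simp add: regular_site_conditional_def)

lemma K_prob_space:
  assumes "i \<in> T" "x \<in> space \<mu>"
  shows "prob_space (K i x)" "sets (K i x) = sets B" "space (K i x) = space B"
proof -
  show "prob_space (K i x)" "sets (K i x) = sets B"
    using measurable_space[OF K_measurable[OF assms(1)], of x] assms(2)
    by (auto simp: space_prob_algebra space_mu)
  then show "space (K i x) = space B" using sets_eq_imp_space_eq by blast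
qed

lemma K_off_site:
  assumes "i \<in> T" "x \<in> space \<mu>" "y \<in> space \<mu>" "\<And>j. j \<in> T - {i} \<Longrightarrow> x j = y j"
  shows "K i x = K i y"
  using K[OF assms(1)] assms(2-) unfolding regular_site_conditional_def space_mu by blast

lemma update_in_space:
  assumes "i \<in> T" "x \<in> space \<mu>" "z \<in> space B"
  shows "x(i := z) \<in> space \<mu>"
proof -
  have "(x, z) \<in> space (Pi\<^sub>M T (\<lambda>_. B) \<Otimes>\<^sub>M B)"
    using assms unfolding space_mu space_pair_measure by blast
  then show ?thesis
    using measurable_space[OF measurable_site_update[OF assms(1)]] by (fastforce simp: space_mu)
qed

lemma update_measurable:
  assumes "i \<in> T" "x \<in> space \<mu>"
  shows "(\<lambda>z. x(i := z)) \<in> B \<rightarrow>\<^sub>M \<mu>"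
proof -
  have "x \<in> space (Pi\<^sub>M T (\<lambda>_. B))" using assms by (simp add: space_mu)
  from measurable_compose[OF measurable_Pair1'[OF this] measurable_site_update[OF assms(1)]]
  show ?thesis by (simp cong: measurable_cong_sets add: sets_mu)
qed

text \<open>Conditional Jensen: the variance under \<open>K i x\<close> is nonnegative, so the
  squared mean is almost everywhere at most the conditional mean of the square, and the latter is
  integrable under \<mu>.\<close>

lemma cond_mean_L2:
  assumes i: "i \<in> T" and f: "f \<in> L2"
  shows "cond_mean K i f \<in> L2"
proof -
  note cm = cond_mean_integral[where K = K, OF finite_T i prob_space_axioms sets_mu K[OF i]]
  have f1: "integrable \<mu> f" and f2: "integrable \<mu> (\<lambda>x. f x * f x)"
    using f L2_integrable[OF f] by (auto simp: L2_iff)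
  let ?m = "cond_mean K i f" and ?q = "cond_mean K i (\<lambda>x. f x * f x)"
  have m: "?m \<in> borel_measurable \<mu>" using cm(2)[OF f1] by auto
  have "AE x in \<mu>. ?m x * ?m x \<le> ?q x"
    using cm(1)[OF f1] cm(1)[OF f2] AE_space
  proof eventually_elim
    case (elim x)
    interpret kx: prob_space "K i x" using K_prob_space[OF i] elim by simp
    have "0 \<le> kx.variance (\<lambda>z. f (x(i := z)))" by simp
    also have "\<dots> = ?q x - ?m x * ?m x"
      using elim by (subst kx.variance_eq) (auto simp: cond_mean_def power2_eq_square)
    finally show ?case by simp
  qed
  then show ?thesis
    using m unfolding L2_iff
    by (auto elim!: eventually_mono intro!: Bochner_Integration.integrable_bound[OF cm(2)[OF f2]])
qed

lemma expectation_cond_mean: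
  assumes "i \<in> T" "f \<in> L2"
  shows "expectation (cond_mean K i f) = expectation f"
  using cond_mean_integral(3)[where K = K, OF finite_T assms(1) prob_space_axioms sets_mu K] assms
  by (simp add: L2_integrable)

text \<open>The conditional mean of f does not depend on the i-th coordinate, hence it factors out
  of the integral against \<open>K i x\<close>. This is the projection property; exchanging f and g
  yields symmetry.\<close>

lemma expectation_cond_mean_mult:
  assumes i: "i \<in> T" and f: "f \<in> L2" and g: "g \<in> L2"
  shows "(\<integral>x. cond_mean K i f x * g x \<partial>\<mu>) = (\<integral>x. cond_mean K i f x * cond_mean K i g x \<partial>\<mu>)"
proof -
  let ?m = "cond_mean K i f"
  have "integrable \<mu> (\<lambda>x. ?m x * g x)" by (rule L2_mult_integrable[OF cond_mean_L2[OF i f] g])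
  from cond_mean_integral(3)[where K = K, OF finite_T i prob_space_axioms sets_mu K[OF i] this]
  have "(\<integral>x. ?m x * g x \<partial>\<mu>) = (\<integral>x. cond_mean K i (\<lambda>x. ?m x * g x) x \<partial>\<mu>)" by simp
  also have "\<dots> = (\<integral>x. ?m x * cond_mean K i g x \<partial>\<mu>)"
  proof (rule Bochner_Integration.integral_cong[OF refl])
    fix x assume x: "x \<in> space \<mu>"
    have "?m (x(i := z)) = ?m x" if "z \<in> space (K i x)" for z
      using K_off_site[OF i update_in_space[OF i x] x] that K_prob_space(3)[OF i x]
      by (simp add: cond_mean_def)
    then have "cond_mean K i (\<lambda>x. ?m x * g x) x = (\<integral>z. ?m x * g (x(i := z)) \<partial>K i x)"
      unfolding cond_mean_def[of K i "\<lambda>x. ?m x * g x"]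
      by (intro Bochner_Integration.integral_cong) simp_all
    then show "cond_mean K i (\<lambda>x. ?m x * g x) x = ?m x * cond_mean K i g x"
      by (simp add: cond_mean_def)
  qed
  finally show ?thesis .
qed

lemma covariance_cond_mean_sym:
  assumes "i \<in> T" "f \<in> L2" "g \<in> L2"
  shows "covariance \<mu> (cond_mean K i f) g = covariance \<mu> f (cond_mean K i g)"
  using expectation_cond_mean_mult[OF assms] expectation_cond_mean_mult[OF assms(1,3,2)]
    expectation_cond_mean[OF assms(1,2)] expectation_cond_mean[OF assms(1,3)]
  by (simp add: covariance_def mult.commute)

lemma covariance_cond_mean_bounds:
  assumes i: "i \<in> T" and f: "f \<in> L2"
  shows "0 \<le> covariance \<mu> (cond_mean K i f) f"
    and "covariance \<mu> (cond_mean K i f) f \<le> covariance \<mu> f f"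
proof -
  let ?m = "cond_mean K i f"
  have m: "?m \<in> L2" by (rule cond_mean_L2[OF i f])
  have eq: "covariance \<mu> ?m f = covariance \<mu> ?m ?m"
    using expectation_cond_mean_mult[OF i f f] expectation_cond_mean[OF i f]
    by (simp add: covariance_def)
  show nonneg: "0 \<le> covariance \<mu> ?m f" unfolding eq by (rule cov.ip_nonneg[OF m])
  \<comment> \<open>Cauchy-Schwarz with the variance of the projection replaced by its covariance
    with f; one factor then cancels.\<close>
  have "covariance \<mu> ?m f * covariance \<mu> ?m f \<le> covariance \<mu> ?m f * covariance \<mu> f f"
    using cov.Cauchy_Schwarz[OF m f] unfolding eq[symmetric] by (simp add: power2_eq_square)
  then show "covariance \<mu> ?m f \<le> covariance \<mu> f f"
    using nonneg cov.ip_nonneg[OF f] by (cases "covariance \<mu> ?m f = 0") auto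
qed

section \<open>The random-scan operator\<close>

definition sweep :: "(('i \<Rightarrow> 'e) \<Rightarrow> real) \<Rightarrow> ('i \<Rightarrow> 'e) \<Rightarrow> real" where
  "sweep f x = (\<Sum>i\<in>T. cond_mean K i f x) / card T"

lemma card_T_pos: "0 < real (card T)"
  using finite_T T_nonempty by (simp add: card_gt_0_iff)

lemma sweep_L2:
  assumes "f \<in> L2"
  shows "sweep f \<in> L2"
  using L2_lincomb[OF L2_bounded[of "\<lambda>_. 0" 0] L2_sum[OF finite_T cond_mean_L2[OF _ assms]],
      where c = "1 / real (card T)"]
  unfolding sweep_def[abs_def] by simp

lemma covariance_sweep:
  assumes f: "f \<in> L2" and g: "g \<in> L2"
  shows "covariance \<mu> (sweep f) g = (\<Sum>i\<in>T. covariance \<mu> (cond_mean K i f) g) / card T"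
proof -
  have i: "integrable \<mu> (\<lambda>x. cond_mean K i f x * g x)" "integrable \<mu> (cond_mean K i f)" if "i \<in> T" for i
    using L2_mult_integrable[OF cond_mean_L2[OF that f] g] L2_integrable[OF cond_mean_L2[OF that f]] by auto
  have "(\<integral>x. sweep f x * g x \<partial>\<mu>) = (\<Sum>i\<in>T. \<integral>x. cond_mean K i f x * g x \<partial>\<mu>) / card T"
    using i(1) by (simp add: sweep_def sum_distrib_right Bochner_Integration.integral_sum)
  moreover have "expectation (sweep f) = (\<Sum>i\<in>T. expectation (cond_mean K i f)) / card T"
    using i(2) by (simp add: sweep_def[abs_def] Bochner_Integration.integral_sum)
  ultimately show ?thesis
    by (simp add: covariance_def sum_subtractf sum_distrib_right diff_divide_distrib)
qed

text \<open>An average of symmetric projections is symmetric, whereas updating the sites one after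
  the other would compose them and in general lose the symmetry on which log-convexity
  rests.\<close>

lemma covariance_sweep_sym:
  assumes f: "f \<in> L2" and g: "g \<in> L2"
  shows "covariance \<mu> (sweep f) g = covariance \<mu> f (sweep g)"
proof -
  have "covariance \<mu> (sweep f) g = covariance \<mu> (sweep g) f"
    unfolding covariance_sweep[OF f g] covariance_sweep[OF g f]
    using covariance_cond_mean_sym[OF _ f g] cov.ip_sym[OF f cond_mean_L2[OF _ g]] by simp
  then show ?thesis using cov.ip_sym[OF f sweep_L2[OF g]] by simp
qed

lemma covariance_sweep_le:
  assumes f: "f \<in> L2"
  shows "\<bar>covariance \<mu> (sweep f) f\<bar> \<le> covariance \<mu> f f"
proof -
  have "0 \<le> (\<Sum>i\<in>T. covariance \<mu> (cond_mean K i f) f)"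
    using covariance_cond_mean_bounds(1)[OF _ f] by (intro sum_nonneg) auto
  moreover have "(\<Sum>i\<in>T. covariance \<mu> (cond_mean K i f) f) \<le> real (card T) * covariance \<mu> f f"
    using covariance_cond_mean_bounds(2)[OF _ f] by (intro sum_bounded_above) auto
  ultimately show ?thesis
    using card_T_pos by (simp add: covariance_sweep[OF f f] field_simps)
qed

text \<open>Conditional means preserve expectations, so in each site term the products of
  expectations cancel and second moments become covariances. The factor \<open>card T\<close> undoes
  the averaging.\<close>

lemma dirichlet_form_eq_covariance:
  assumes f: "f \<in> L2"
  shows "dirichlet_form T \<mu> K f = card T * (covariance \<mu> f f - covariance \<mu> (sweep f) f)"
proof -
  have i: "integrable \<mu> (\<lambda>x. f x * f x)" "\<And>i. i \<in> T \<Longrightarrow> integrable \<mu> (\<lambda>x. cond_mean K i f x * f x)"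
    using f L2_mult_integrable[OF cond_mean_L2[OF _ f] f] by (auto simp: L2_iff)
  have "dirichlet_form T \<mu> K f = (\<integral>x. - generator T K f x * f x \<partial>\<mu>)"
    by (rule dirichlet_form_eq_generator[OF finite_T prob_space_axioms sets_mu K f])
  also have "\<dots> = (\<integral>x. (\<Sum>i\<in>T. f x * f x - cond_mean K i f x * f x) \<partial>\<mu>)"
    by (simp add: generator_def sum_distrib_left sum_negf[symmetric] algebra_simps)
  also have "\<dots> = (\<Sum>i\<in>T. (\<integral>x. f x * f x \<partial>\<mu>) - (\<integral>x. cond_mean K i f x * f x \<partial>\<mu>))"
    using i by (subst Bochner_Integration.integral_sum) auto
  also have "\<dots> = (\<Sum>i\<in>T. covariance \<mu> f f - covariance \<mu> (cond_mean K i f) f)"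
    using expectation_cond_mean[OF _ f] by (intro sum.cong) (auto simp: covariance_def)
  also have "\<dots> = card T * (covariance \<mu> f f - covariance \<mu> (sweep f) f)"
    using card_T_pos by (simp add: sum_subtractf covariance_sweep[OF f f] algebra_simps)
  finally show ?thesis .
qed

end

section \<open>The Dobrushin contraction\<close>

text \<open>The easy half of Kantorovich duality: every coupling bounds the difference of the
  integrals by l times its cost, so the infimum does too and no optimal coupling has to
  exist.\<close>

lemma wasserstein1_dual_bound:
  fixes h :: "'e \<Rightarrow> real"
  assumes \<nu>1: "prob_space \<nu>1" "sets \<nu>1 = sets B" and \<nu>2: "sets \<nu>2 = sets B"
    and h: "h \<in> borel_measurable B" and b: "\<And>z. z \<in> space B \<Longrightarrow> \<bar>h z\<bar> \<le> b"
    and l: "0 < l" and lip: "\<And>z w. z \<in> space B \<Longrightarrow> w \<in> space B \<Longrightarrow> \<bar>h z - h w\<bar> \<le> l * d z w"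
    and W: "wasserstein1 B d \<nu>1 \<nu>2 \<le> ennreal c" and c: "0 \<le> c"
  shows "\<bar>(\<integral>z. h z \<partial>\<nu>1) - (\<integral>z. h z \<partial>\<nu>2)\<bar> \<le> l * c"
proof -
  let ?D = "\<bar>(\<integral>z. h z \<partial>\<nu>1) - (\<integral>z. h z \<partial>\<nu>2)\<bar>"
  have "ennreal (?D / l) \<le> (\<integral>\<^sup>+(z, w). ennreal (d z w) \<partial>\<pi>)" if "\<pi> \<in> couplings B \<nu>1 \<nu>2" for \<pi>
  proof -
    have \<pi>: "sets \<pi> = sets (B \<Otimes>\<^sub>M B)" "distr \<pi> B fst = \<nu>1" "distr \<pi> B snd = \<nu>2"
      using that by (auto simp: couplings_def)
    note \<pi>(1)[measurable_cong]
    have sp: "space \<pi> = space B \<times> space B"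
      using sets_eq_imp_space_eq[OF \<pi>(1)] by (simp add: space_pair_measure)
    have m: "fst \<in> \<pi> \<rightarrow>\<^sub>M B" "snd \<in> \<pi> \<rightarrow>\<^sub>M B" by measurable
    \<comment> \<open>Couplings are not declared to be probability measures; the total mass is read
      off the first marginal.\<close>
    have "emeasure \<pi> (space \<pi>) = emeasure (distr \<pi> B fst) (space (distr \<pi> B fst))"
      using m by (simp add: emeasure_distr) (rule arg_cong[where f = "emeasure \<pi>"], auto simp: sp)
    then have "prob_space \<pi>"
      using prob_space.emeasure_space_1[OF \<nu>1(1)] unfolding \<pi>(2) by (intro prob_spaceI) simp
    then interpret prob_space \<pi> .
    have hm: "(\<lambda>p. h (fst p)) \<in> borel_measurable \<pi>" "(\<lambda>p. h (snd p)) \<in> borel_measurable \<pi>"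
      using measurable_compose[OF m(1) h] measurable_compose[OF m(2) h] by auto
    have i: "integrable \<pi> (\<lambda>p. h (fst p))" "integrable \<pi> (\<lambda>p. h (snd p))"
      using hm b by (auto intro!: integrable_const_bound[where B = b] simp: sp)
    have "(\<integral>z. h z \<partial>\<nu>1) - (\<integral>z. h z \<partial>\<nu>2) = (\<integral>p. h (fst p) - h (snd p) \<partial>\<pi>)"
      unfolding \<pi>(2,3)[symmetric] using i by (simp add: integral_distr[OF m(1) h] integral_distr[OF m(2) h])
    then have "?D \<le> (\<integral>p. \<bar>h (fst p) - h (snd p)\<bar> \<partial>\<pi>)"
      using integral_abs_bound[of \<pi> "\<lambda>p. h (fst p) - h (snd p)"] by simp
    then have "ennreal (?D / l) \<le> ennreal (\<integral>p. \<bar>h (fst p) - h (snd p)\<bar> / l \<partial>\<pi>)"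
      using l by (intro ennreal_leI) (simp add: divide_right_mono)
    also have "\<dots> = (\<integral>\<^sup>+p. ennreal (\<bar>h (fst p) - h (snd p)\<bar> / l) \<partial>\<pi>)"
      using i l by (intro nn_integral_eq_integral[symmetric]) auto
    also have "\<dots> \<le> (\<integral>\<^sup>+(z, w). ennreal (d z w) \<partial>\<pi>)"
    proof (rule nn_integral_mono)
      fix p assume "p \<in> space \<pi>"
      then have "\<bar>h (fst p) - h (snd p)\<bar> \<le> l * d (fst p) (snd p)" using lip by (auto simp: sp)
      then show "ennreal (\<bar>h (fst p) - h (snd p)\<bar> / l) \<le> (case p of (z, w) \<Rightarrow> ennreal (d z w))"
        using l by (auto simp: case_prod_beta' field_simps intro!: ennreal_leI)
    qed
    finally show ?thesis .
  qed
  then have "ennreal (?D / l) \<le> wasserstein1 B d \<nu>1 \<nu>2"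
    unfolding wasserstein1_def by (intro INF_greatest)
  then have "?D / l \<le> c" using W c by (auto dest: order_trans)
  then show ?thesis using l by (simp add: field_simps)
qed

text \<open>The properties of d listed here are drawn from both kinds of state space, so that one
  argument covers them.\<close>

locale metric_gibbs_sampler = gibbs_sampler \<mu> T B K
  for \<mu> :: "('i \<Rightarrow> 'e) measure" and T :: "'i set" and B :: "'e measure"
    and K :: "'i \<Rightarrow> ('i \<Rightarrow> 'e) \<Rightarrow> 'e measure" +
  fixes d :: "'e \<Rightarrow> 'e \<Rightarrow> real"
  assumes d_refl: "z \<in> space B \<Longrightarrow> d z z = 0"
    and d_pos: "z \<in> space B \<Longrightarrow> w \<in> space B \<Longrightarrow> z \<noteq> w \<Longrightarrow> 0 < d z w"
    and d_measurable: "w \<in> space B \<Longrightarrow> (\<lambda>z. d z w) \<in> borel_measurable B"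
    and coeff_finite: "i \<in> T \<Longrightarrow> j \<in> T \<Longrightarrow> dobrushin_coeff T B d K i j < \<infinity>"
begin

abbreviation coeff :: "'i \<Rightarrow> 'i \<Rightarrow> real" where
  "coeff i j \<equiv> enn2real (dobrushin_coeff T B d K i j)"

definition coord_lipschitz :: "('i \<Rightarrow> real) \<Rightarrow> (('i \<Rightarrow> 'e) \<Rightarrow> real) \<Rightarrow> bool" where
  "coord_lipschitz L f \<longleftrightarrow> (\<forall>j\<in>T. \<forall>x\<in>space \<mu>. \<forall>y\<in>space \<mu>.
     (\<forall>k\<in>T - {j}. x k = y k) \<longrightarrow> \<bar>f x - f y\<bar> \<le> L j * d (x j) (y j))"

definition bounded_measurable :: "(('i \<Rightarrow> 'e) \<Rightarrow> real) \<Rightarrow> bool" where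
  "bounded_measurable f \<longleftrightarrow> f \<in> borel_measurable \<mu> \<and> (\<exists>b. \<forall>x\<in>space \<mu>. \<bar>f x\<bar> \<le> b)"

lemma coord_lipschitzD:
  assumes "coord_lipschitz L f" "j \<in> T" "x \<in> space \<mu>" "y \<in> space \<mu>"
    and "\<And>k. k \<in> T \<Longrightarrow> k \<noteq> j \<Longrightarrow> x k = y k"
  shows "\<bar>f x - f y\<bar> \<le> L j * d (x j) (y j)"
  using assms unfolding coord_lipschitz_def by blast

lemma d_nonneg: "z \<in> space B \<Longrightarrow> w \<in> space B \<Longrightarrow> 0 \<le> d z w"
  using d_refl d_pos by (cases "z = w") (auto intro: less_imp_le)

lemma coord_in_space: "x \<in> space \<mu> \<Longrightarrow> j \<in> T \<Longrightarrow> x j \<in> space B"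
  by (auto simp: space_mu space_PiM)

lemma space_eqI: "x \<in> space \<mu> \<Longrightarrow> y \<in> space \<mu> \<Longrightarrow> (\<And>j. j \<in> T \<Longrightarrow> x j = y j) \<Longrightarrow> x = y"
  unfolding space_mu space_PiM by (rule PiE_ext)

lemma bounded_measurable_L2: "bounded_measurable f \<Longrightarrow> f \<in> L2"
  unfolding bounded_measurable_def using L2_bounded by blast

text \<open>The supremum ranges over pairs that differ at j, where d is positive and finite and the
  quotient in [0, \<infinity>] can be multiplied out.\<close>

lemma wasserstein1_le_coeff:
  assumes i: "i \<in> T" and j: "j \<in> T" and x: "x \<in> space \<mu>" and y: "y \<in> space \<mu>"
    and off: "\<And>k. k \<in> T \<Longrightarrow> k \<noteq> j \<Longrightarrow> x k = y k" and ne: "x j \<noteq> y j"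
  shows "wasserstein1 B d (K i x) (K i y) \<le> ennreal (coeff i j * d (x j) (y j))"
proof -
  let ?W = "wasserstein1 B d (K i x) (K i y)" and ?d = "ennreal (d (x j) (y j))"
  have d: "0 < d (x j) (y j)" using d_pos coord_in_space x y j ne by blast
  have "?W / ?d \<le> dobrushin_coeff T B d K i j"
    unfolding dobrushin_coeff_def using x y off ne by (intro Sup_upper) (auto simp: space_mu)
  also have "\<dots> = ennreal (coeff i j)" using coeff_finite[OF i j] by (simp add: less_top)
  finally have "?W / ?d * ?d \<le> ennreal (coeff i j) * ?d" by (intro mult_right_mono) auto
  moreover have "?W / ?d * ?d = ?W" using d by (simp add: ennreal_divide_times)
  ultimately show ?thesis using d by (simp add: ennreal_mult)
qed

lemma bounded_measurable_section:
  assumes "bounded_measurable f" "i \<in> T" "x \<in> space \<mu>"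
  shows "(\<lambda>z. f (x(i := z))) \<in> borel_measurable B"
    and "\<exists>b. \<forall>z\<in>space B. \<bar>f (x(i := z))\<bar> \<le> b"
  using measurable_compose[OF update_measurable[OF assms(2,3)], of f borel] assms(1)
    update_in_space[OF assms(2,3)]
  unfolding bounded_measurable_def by blast+

text \<open>Resampling site i erases the old value there; this provides the vanishing diagonal term
  in \<open>sweep_lipschitz\<close>.\<close>

lemma cond_mean_eq_off_site:
  assumes i: "i \<in> T" and x: "x \<in> space \<mu>" and y: "y \<in> space \<mu>"
    and off: "\<And>k. k \<in> T \<Longrightarrow> k \<noteq> i \<Longrightarrow> x k = y k"
  shows "cond_mean K i f x = cond_mean K i f y"
proof -
  have "x(i := z) = y(i := z)" if "z \<in> space B" for z
    by (rule space_eqI[OF update_in_space[OF i x that] update_in_space[OF i y that]]) (simp add: off)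
  then show ?thesis
    unfolding cond_mean_def using K_off_site[OF i x y] off K_prob_space(3)[OF i y]
    by (auto intro!: Bochner_Integration.integral_cong)
qed

text \<open>Passing from x to y changes the kernel and the integrand, one at a time, through the
  integral of the x-section against \<open>K i y\<close>. The kernel change costs \<open>L i\<close>
  times a Wasserstein distance; the integrand change is a move at j alone, with the same z inserted
  on both sides.\<close>

lemma cond_mean_lipschitz:
  assumes f: "bounded_measurable f" and lip: "coord_lipschitz L f"
    and L: "\<And>j. j \<in> T \<Longrightarrow> 0 < L j"
    and i: "i \<in> T" and j: "j \<in> T" and ij: "i \<noteq> j" and x: "x \<in> space \<mu>" and y: "y \<in> space \<mu>"
    and off: "\<And>k. k \<in> T \<Longrightarrow> k \<noteq> j \<Longrightarrow> x k = y k"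
  shows "\<bar>cond_mean K i f x - cond_mean K i f y\<bar> \<le> (L j + L i * coeff i j) * d (x j) (y j)"
proof (cases "x j = y j")
  case True
  then have "x = y" using off by (intro space_eqI[OF x y]) metis
  then show ?thesis using d_refl coord_in_space[OF y j] by simp
next
  case False
  let ?h = "\<lambda>x z. f (x(i := z))"
  note Kx = K_prob_space[OF i x] and Ky = K_prob_space[OF i y]
  interpret ky: prob_space "K i y" by (rule Ky(1))
  have dn: "0 \<le> d (x j) (y j)" using d_nonneg coord_in_space x y j by blast
  obtain b where b: "\<And>z. z \<in> space B \<Longrightarrow> \<bar>?h x z\<bar> \<le> b"
    using bounded_measurable_section(2)[OF f i x] by blast
  obtain b' where b': "\<And>z. z \<in> space B \<Longrightarrow> \<bar>?h y z\<bar> \<le> b'"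
    using bounded_measurable_section(2)[OF f i y] by blast
  have hx: "?h x \<in> borel_measurable B" and hy: "?h y \<in> borel_measurable B"
    using bounded_measurable_section(1)[OF f i x] bounded_measurable_section(1)[OF f i y] .
  have lip_h: "\<bar>?h x z - ?h x w\<bar> \<le> L i * d z w" if "z \<in> space B" "w \<in> space B" for z w
    using coord_lipschitzD[OF lip i update_in_space[OF i x that(1)] update_in_space[OF i x that(2)]] by simp
  have "\<bar>(\<integral>z. ?h x z \<partial>K i x) - (\<integral>z. ?h x z \<partial>K i y)\<bar> \<le> L i * (coeff i j * d (x j) (y j))"
    by (rule wasserstein1_dual_bound[OF Kx(1,2) Ky(2) hx b L[OF i] lip_h
          wasserstein1_le_coeff[OF i j x y off False]]) (use dn in auto)
  moreover have "\<bar>(\<integral>z. ?h x z \<partial>K i y) - (\<integral>z. ?h y z \<partial>K i y)\<bar> \<le> L j * d (x j) (y j)"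
  proof -
    have "integrable (K i y) (?h x)"
      using b hx Ky by (auto intro!: ky.integrable_const_bound[where B = b] cong: measurable_cong_sets)
    moreover have "integrable (K i y) (?h y)"
      using b' hy Ky by (auto intro!: ky.integrable_const_bound[where B = b'] cong: measurable_cong_sets)
    ultimately have int: "integrable (K i y) (?h x)" "integrable (K i y) (?h y)" .
    have "(\<integral>z. ?h x z \<partial>K i y) - (\<integral>z. ?h y z \<partial>K i y) = (\<integral>z. ?h x z - ?h y z \<partial>K i y)"
      using int by simp
    also have "\<bar>\<dots>\<bar> \<le> (\<integral>z. \<bar>?h x z - ?h y z\<bar> \<partial>K i y)"
      by (rule integral_abs_bound)
    also have "\<dots> \<le> (\<integral>z. L j * d (x j) (y j) \<partial>K i y)"
    proof (rule integral_mono)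
      fix z assume "z \<in> space (K i y)"
      then have z: "z \<in> space B" using Ky(3) by simp
      have "\<bar>?h x z - ?h y z\<bar> \<le> L j * d ((x(i := z)) j) ((y(i := z)) j)"
        by (rule coord_lipschitzD[OF lip j update_in_space[OF i x z] update_in_space[OF i y z]])
          (simp add: off)
      then show "\<bar>?h x z - ?h y z\<bar> \<le> L j * d (x j) (y j)" using ij by simp
    qed (use int in auto)
    finally show ?thesis by (simp add: ky.prob_space)
  qed
  ultimately show ?thesis by (simp add: cond_mean_def algebra_simps)
qed

lemma sweep_bounded_measurable:
  assumes f: "bounded_measurable f"
  shows "bounded_measurable (sweep f)"
proof -
  obtain b where b: "\<And>x. x \<in> space \<mu> \<Longrightarrow> \<bar>f x\<bar> \<le> b"
    using f by (auto simp: bounded_measurable_def)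
  have "\<bar>cond_mean K i f x\<bar> \<le> b" if i: "i \<in> T" and x: "x \<in> space \<mu>" for i x
  proof -
    note Kx = K_prob_space[OF i x]
    interpret kx: prob_space "K i x" by (rule Kx(1))
    have bz: "\<bar>f (x(i := z))\<bar> \<le> b" if "z \<in> space (K i x)" for z
      using b update_in_space[OF i x] that Kx(3) by blast
    have int: "integrable (K i x) (\<lambda>z. f (x(i := z)))"
      using bounded_measurable_section(1)[OF f i x] Kx bz
      by (auto intro!: kx.integrable_const_bound[where B = b] cong: measurable_cong_sets)
    have "\<bar>cond_mean K i f x\<bar> \<le> (\<integral>z. \<bar>f (x(i := z))\<bar> \<partial>K i x)"
      unfolding cond_mean_def by (rule integral_abs_bound)
    also have "\<dots> \<le> (\<integral>z. b \<partial>K i x)"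
      by (rule integral_mono) (use int bz in auto)
    finally show ?thesis by (simp add: kx.prob_space)
  qed
  then have "\<bar>\<Sum>i\<in>T. cond_mean K i f x\<bar> \<le> card T * b" if "x \<in> space \<mu>" for x
    using that by (intro order_trans[OF sum_abs] sum_bounded_above) auto
  then have "\<bar>sweep f x\<bar> \<le> b" if "x \<in> space \<mu>" for x
    using that card_T_pos by (simp add: sweep_def field_simps)
  then show ?thesis
    using sweep_L2[OF bounded_measurable_L2[OF f]] by (auto simp: bounded_measurable_def L2_iff)
qed

text \<open>The profile v is kept and only the scalar a changes, so the estimate can be iterated
  without tracking a vector of constants.\<close>

lemma sweep_lipschitz:
  assumes f: "bounded_measurable f" and lip: "coord_lipschitz (\<lambda>j. a * v j) f" and a: "0 < a"
    and v: "\<And>j. j \<in> T \<Longrightarrow> 0 < v j" and sub: "\<And>j. j \<in> T \<Longrightarrow> (\<Sum>i\<in>T. v i * coeff i j) \<le> s * v j"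
  shows "coord_lipschitz (\<lambda>j. ((1 - (1 - s) / card T) * a) * v j) (sweep f)"
  unfolding coord_lipschitz_def
proof (intro ballI impI)
  fix j x y
  assume j: "j \<in> T" and x: "x \<in> space \<mu>" and y: "y \<in> space \<mu>" and off: "\<forall>k\<in>T - {j}. x k = y k"
  let ?d = "d (x j) (y j)"
  have dn: "0 \<le> ?d" using d_nonneg coord_in_space x y j by blast
  have L: "0 < a * v j" if "j \<in> T" for j using a v[OF that] by simp
  \<comment> \<open>At i = j the left side is 0; the nonnegative diagonal term is kept on the right
    so that the second sum runs over all of T, as in \<open>sub\<close>.\<close>
  have "\<bar>cond_mean K i f x - cond_mean K i f y\<bar>
      \<le> (if i = j then 0 else a * v j * ?d) + a * (v i * coeff i j) * ?d" if i: "i \<in> T" for i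
  proof (cases "i = j")
    case True
    have "0 \<le> a * (v i * coeff i j) * ?d" using a v[OF i] dn by simp
    then show ?thesis using cond_mean_eq_off_site[OF i x y] off True by simp
  next
    case False
    then show ?thesis
      using cond_mean_lipschitz[OF f lip L i j False x y] off by (simp add: algebra_simps)
  qed
  then have "(\<Sum>i\<in>T. \<bar>cond_mean K i f x - cond_mean K i f y\<bar>)
      \<le> (\<Sum>i\<in>T. (if i = j then 0 else a * v j * ?d) + a * (v i * coeff i j) * ?d)"
    by (intro sum_mono)
  also have "\<dots> = (\<Sum>i\<in>T - {j}. a * v j * ?d) + a * (\<Sum>i\<in>T. v i * coeff i j) * ?d"
  proof -
    have "(\<Sum>i\<in>T. if i = j then 0 else a * v j * ?d) = (\<Sum>i\<in>T - {j}. a * v j * ?d)"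
      using finite_T j by (subst sum.remove[of T j]) auto
    then show ?thesis by (simp add: sum.distrib sum_distrib_left sum_distrib_right)
  qed
  also have "\<dots> \<le> (real (card T) - 1) * (a * v j * ?d) + a * (s * v j) * ?d"
  proof -
    have "real (card (T - {j})) = real (card T) - 1"
      using finite_T j card_T_pos by (simp add: card_Diff_singleton of_nat_diff Suc_le_eq)
    moreover have "a * (\<Sum>i\<in>T. v i * coeff i j) * ?d \<le> a * (s * v j) * ?d"
      using sub[OF j] a dn by (intro mult_right_mono mult_left_mono) auto
    ultimately show ?thesis by simp
  qed
  also have "\<dots> = card T * (((1 - (1 - s) / card T) * a) * v j * ?d)"
    using card_T_pos by (simp add: field_simps)
  finally have le: "(\<Sum>i\<in>T. \<bar>cond_mean K i f x - cond_mean K i f y\<bar>)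
      \<le> card T * (((1 - (1 - s) / card T) * a) * v j * ?d)" .
  have "sweep f x - sweep f y = (\<Sum>i\<in>T. cond_mean K i f x - cond_mean K i f y) / card T"
    by (simp add: sweep_def sum_subtractf diff_divide_distrib)
  also have "\<bar>\<dots>\<bar> \<le> (\<Sum>i\<in>T. \<bar>cond_mean K i f x - cond_mean K i f y\<bar>) / card T"
    by (simp add: divide_right_mono)
  also have "\<dots> \<le> ((1 - (1 - s) / card T) * a) * v j * ?d"
    using le card_T_pos by (simp add: divide_le_eq mult.commute)
  finally show "\<bar>sweep f x - sweep f y\<bar> \<le> ((1 - (1 - s) / card T) * a) * v j * ?d" .
qed

section \<open>From coordinatewise Lipschitz constants to decay of the variance\<close>

lemma coord_lipschitz_sum:
  assumes lip: "coord_lipschitz L f" and x: "x \<in> space \<mu>" and y: "y \<in> space \<mu>"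
  shows "\<bar>f x - f y\<bar> \<le> (\<Sum>j\<in>T. L j * d (x j) (y j))"
proof -
  \<comment> \<open>Interpolation from x to y: enlarging S by one site changes one coordinate, so
    the Lipschitz bounds telescope.\<close>
  define m where "m S = (\<lambda>k. if k \<in> S then y k else x k)" for S
  have m: "m S \<in> space \<mu>" if "S \<subseteq> T" for S
    using x y that by (auto simp: m_def space_mu space_PiM PiE_iff extensional_def)
  have "\<bar>f x - f (m S)\<bar> \<le> (\<Sum>j\<in>S. L j * d (x j) (y j))" if "finite S" "S \<subseteq> T" for S
    using that
  proof (induction S)
    case empty
    show ?case by (simp add: m_def)
  next
    case (insert j S)
    have "\<bar>f (m S) - f (m (insert j S))\<bar> \<le> L j * d (m S j) (m (insert j S) j)"
      using insert by (intro coord_lipschitzD[OF lip] m) (auto simp: m_def)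
    also have "\<dots> = L j * d (x j) (y j)" using insert by (simp add: m_def)
    finally have "\<bar>f (m S) - f (m (insert j S))\<bar> \<le> L j * d (x j) (y j)" .
    moreover have "\<bar>f x - f (m S)\<bar> \<le> (\<Sum>j\<in>S. L j * d (x j) (y j))" using insert by simp
    ultimately have "\<bar>f x - f (m (insert j S))\<bar>
        \<le> L j * d (x j) (y j) + (\<Sum>j\<in>S. L j * d (x j) (y j))"
      by linarith
    then show ?case using insert by simp
  qed
  from this[OF finite_T] have "\<bar>f x - f (m T)\<bar> \<le> (\<Sum>j\<in>T. L j * d (x j) (y j))" by simp
  moreover have "m T = y" by (rule space_eqI[OF m y]) (auto simp: m_def)
  ultimately show ?thesis by simp
qed

text \<open>Centering at the value of f at y, the point with finite second moments, turns the
  Lipschitz bound into a bound on the variance.\<close>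

lemma covariance_le_lipschitz:
  assumes f: "bounded_measurable f" and lip: "coord_lipschitz (\<lambda>j. a * v j) f" and a: "0 \<le> a"
    and v: "\<And>j. j \<in> T \<Longrightarrow> 0 \<le> v j" and y: "y \<in> space \<mu>"
    and moment: "\<And>j. j \<in> T \<Longrightarrow> (\<integral>\<^sup>+x. ennreal ((d (x j) (y j))\<^sup>2) \<partial>\<mu>) < \<infinity>"
  shows "covariance \<mu> f f \<le> a\<^sup>2 * (\<integral>x. (\<Sum>j\<in>T. v j * d (x j) (y j))\<^sup>2 \<partial>\<mu>)"
proof -
  let ?S = "\<lambda>x. \<Sum>j\<in>T. v j * d (x j) (y j)"
  have dm: "(\<lambda>x. d (x j) (y j)) \<in> borel_measurable \<mu>" if "j \<in> T" for j
  proof -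
    have "(\<lambda>x. x j) \<in> \<mu> \<rightarrow>\<^sub>M B"
      using measurable_component_singleton[OF that, of "\<lambda>_. B"] by (simp cong: measurable_cong_sets add: sets_mu)
    from measurable_compose[OF this d_measurable[OF coord_in_space[OF y that]]] show ?thesis .
  qed
  have "(\<lambda>x. d (x j) (y j)) \<in> L2" if "j \<in> T" for j
    using dm[OF that] moment[OF that]
    by (auto simp: square_integrable_def intro!: integrableI_nonneg)
  then have "(\<lambda>x. v j * d (x j) (y j)) \<in> L2" if "j \<in> T" for j
    using L2_lincomb[OF L2_bounded[of "\<lambda>_. 0" 0], of "\<lambda>x. d (x j) (y j)" "v j"] that by simp
  then have S: "?S \<in> L2" by (intro L2_sum finite_T)
  have f2: "f \<in> L2" by (rule bounded_measurable_L2[OF f])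
  have "covariance \<mu> f f \<le> (\<integral>x. (f x - f y)\<^sup>2 \<partial>\<mu>)" by (rule covariance_le_second_moment[OF f2])
  also have "\<dots> \<le> (\<integral>x. a\<^sup>2 * (?S x)\<^sup>2 \<partial>\<mu>)"
  proof (rule integral_mono)
    show "integrable \<mu> (\<lambda>x. (f x - f y)\<^sup>2)"
      using cov.diff_closed[OF f2 L2_bounded[of "\<lambda>_. f y" "\<bar>f y\<bar>"]] by (simp add: square_integrable_def)
    show "integrable \<mu> (\<lambda>x. a\<^sup>2 * (?S x)\<^sup>2)" using S by (simp add: square_integrable_def)
    fix x assume x: "x \<in> space \<mu>"
    have "\<bar>f x - f y\<bar> \<le> a * ?S x"
      using coord_lipschitz_sum[OF lip x y] by (simp add: sum_distrib_left mult.assoc)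
    moreover have "0 \<le> a * ?S x"
      using a v d_nonneg coord_in_space x y by (intro mult_nonneg_nonneg sum_nonneg) auto
    ultimately have "(f x - f y)\<^sup>2 \<le> (a * ?S x)\<^sup>2" by (simp add: abs_le_square_iff[symmetric])
    then show "(f x - f y)\<^sup>2 \<le> a\<^sup>2 * (?S x)\<^sup>2" by (simp add: power_mult_distrib)
  qed
  finally show ?thesis by simp
qed

lemma sweep_iterate_decay:
  assumes f: "bounded_measurable f" and lip: "coord_lipschitz (\<lambda>j. a * v j) f" and a: "0 < a"
    and v: "\<And>j. j \<in> T \<Longrightarrow> 0 < v j" and sub: "\<And>j. j \<in> T \<Longrightarrow> (\<Sum>i\<in>T. v i * coeff i j) \<le> s * v j"
    and s: "0 < s" and y: "y \<in> space \<mu>"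
    and moment: "\<And>j. j \<in> T \<Longrightarrow> (\<integral>\<^sup>+x. ennreal ((d (x j) (y j))\<^sup>2) \<partial>\<mu>) < \<infinity>"
  shows "covariance \<mu> ((sweep ^^ k) f) ((sweep ^^ k) f)
    \<le> (a\<^sup>2 * (\<integral>x. (\<Sum>j\<in>T. v j * d (x j) (y j))\<^sup>2 \<partial>\<mu>)) * ((1 - (1 - s) / card T)\<^sup>2) ^ k"
proof -
  let ?\<theta> = "1 - (1 - s) / card T"
  have "1 \<le> real (card T)" using card_T_pos by simp
  \<comment> \<open>\<theta> equals (n - 1 + s)/n. Its positivity keeps the scale of every iterate
    positive, as \<open>sweep_lipschitz\<close> requires.\<close>
  then have \<theta>: "0 < ?\<theta>" using s card_T_pos by (simp add: field_simps)
  have it: "bounded_measurable ((sweep ^^ k) f) \<and> coord_lipschitz (\<lambda>j. (?\<theta> ^ k * a) * v j) ((sweep ^^ k) f)"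
  proof (induction k)
    case 0
    then show ?case using f lip by simp
  next
    case (Suc k)
    have "0 < ?\<theta> ^ k * a" using \<theta> a by simp
    from sweep_lipschitz[OF _ _ this v sub] sweep_bounded_measurable Suc
    show ?case by (simp add: mult.assoc)
  qed
  have "covariance \<mu> ((sweep ^^ k) f) ((sweep ^^ k) f)
      \<le> (?\<theta> ^ k * a)\<^sup>2 * (\<integral>x. (\<Sum>j\<in>T. v j * d (x j) (y j))\<^sup>2 \<partial>\<mu>)"
    using it \<theta> a v by (intro covariance_le_lipschitz y moment) (auto intro: less_imp_le)
  then show ?thesis by (simp add: power_mult_distrib power_mult[symmetric] mult_ac)
qed

end

section \<open>Density of Lipschitz functions\<close>

text \<open>The Lipschitz constant may grow with n, which is harmless because the contraction factor
  does not depend on it. The range [0,1] lets products inherit the one-site constants and supplies a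
  dominating function.\<close>

definition lipschitz_approximation ::
  "'e measure \<Rightarrow> ('e \<Rightarrow> 'e \<Rightarrow> real) \<Rightarrow> 'e set \<Rightarrow> (nat \<Rightarrow> 'e \<Rightarrow> real) \<Rightarrow> bool" where
  "lipschitz_approximation B d A h \<longleftrightarrow>
     (\<forall>n. h n \<in> borel_measurable B) \<and>
     (\<forall>n. \<forall>z\<in>space B. 0 \<le> h n z \<and> h n z \<le> 1) \<and>
     (\<forall>n. \<exists>l. \<forall>z\<in>space B. \<forall>w\<in>space B. \<bar>h n z - h n w\<bar> \<le> l * d z w) \<and>
     (\<forall>z\<in>space B. (\<lambda>n. h n z) \<longlonglongrightarrow> indicator A z)"

text \<open>The interface between density and the state space: G will be the open sets for a Polish
  metric and all measurable sets for the trivial one.\<close>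

definition lipschitz_generator :: "'e measure \<Rightarrow> ('e \<Rightarrow> 'e \<Rightarrow> real) \<Rightarrow> 'e set set \<Rightarrow> bool" where
  "lipschitz_generator B d G \<longleftrightarrow> Int_stable G \<and> G \<subseteq> Pow (space B) \<and> space B \<in> G \<and>
     sets B = sigma_sets (space B) G \<and> (\<forall>A\<in>G. \<exists>h. lipschitz_approximation B d A h)"

text \<open>Membership of \<open>space B\<close> in G serves as the countable cover of each factor,
  and T itself is the single block of the cover of the index set.\<close>

lemma sets_PiM_rectangles:
  assumes T: "finite T" and G: "G \<subseteq> Pow (space B)" "space B \<in> G" "sets B = sigma_sets (space B) G"
  shows "sets (Pi\<^sub>M T (\<lambda>_. B)) = sigma_sets (space (Pi\<^sub>M T (\<lambda>_. B)))
    {{x \<in> space (Pi\<^sub>M T (\<lambda>_. B)). \<forall>i\<in>T. x i \<in> F i} | F. \<forall>i\<in>T. F i \<in> G}"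
proof -
  have sB: "sets (sigma (space B) G) = sets B" using G by simp
  have "sets (Pi\<^sub>M T (\<lambda>_. B)) = sets (Pi\<^sub>M T (\<lambda>_. sigma (space B) G))"
    by (intro sets_PiM_cong) (simp_all add: sB)
  also have "\<dots> = sets (sigma (Pi\<^sub>E T (\<lambda>_. space B))
      {{x \<in> Pi\<^sub>E T (\<lambda>_. space B). \<forall>i\<in>j. x i \<in> F i} | F j. j \<in> {T} \<and> F \<in> Pi j (\<lambda>_. G)})"
    by (rule sets_PiM_sigma) (use T G in \<open>auto intro!: exI[of _ "{space B}"]\<close>)
  also have "{{x \<in> Pi\<^sub>E T (\<lambda>_. space B). \<forall>i\<in>j. x i \<in> F i} | F j. j \<in> {T} \<and> F \<in> Pi j (\<lambda>_. G)}
      = {{x \<in> Pi\<^sub>E T (\<lambda>_. space B). \<forall>i\<in>T. x i \<in> F i} | F. \<forall>i\<in>T. F i \<in> G}"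
    by (auto simp: Pi_iff)
  finally show ?thesis by (subst (asm) sets_measure_of) (auto simp: space_PiM)
qed

context metric_gibbs_sampler
begin

definition lipschitz_functions :: "(('i \<Rightarrow> 'e) \<Rightarrow> real) set" where
  "lipschitz_functions = {f. bounded_measurable f \<and> (\<exists>L. coord_lipschitz L f)}"

definition approximable :: "(('i \<Rightarrow> 'e) \<Rightarrow> real) \<Rightarrow> bool" where
  "approximable f \<longleftrightarrow> (\<forall>e>0. \<exists>h\<in>lipschitz_functions. (\<integral>x. (f x - h x)\<^sup>2 \<partial>\<mu>) < e)"

lemma lipschitz_functions_L2: "lipschitz_functions \<subseteq> L2"
  using bounded_measurable_L2 by (auto simp: lipschitz_functions_def)

lemma lipschitz_functions_approximable: "f \<in> lipschitz_functions \<Longrightarrow> approximable f"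
  unfolding approximable_def by (intro allI impI bexI[of _ f]) auto

lemma lipschitz_functions_const: "(\<lambda>_. c) \<in> lipschitz_functions"
  by (auto simp: lipschitz_functions_def bounded_measurable_def coord_lipschitz_def intro!: exI[of _ "\<lambda>_. 0"])

lemma lipschitz_functions_lincomb:
  assumes f: "f \<in> lipschitz_functions" and g: "g \<in> lipschitz_functions"
  shows "(\<lambda>x. f x + c * g x) \<in> lipschitz_functions"
proof -
  obtain L L' b b' where L: "coord_lipschitz L f" "coord_lipschitz L' g"
    and b: "\<And>x. x \<in> space \<mu> \<Longrightarrow> \<bar>f x\<bar> \<le> b" "\<And>x. x \<in> space \<mu> \<Longrightarrow> \<bar>g x\<bar> \<le> b'"
    and m: "f \<in> borel_measurable \<mu>" "g \<in> borel_measurable \<mu>"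
    using f g unfolding lipschitz_functions_def bounded_measurable_def by blast
  have "\<bar>f x + c * g x\<bar> \<le> b + \<bar>c\<bar> * b'" if "x \<in> space \<mu>" for x
    using b[OF that] mult_left_mono[OF b(2)[OF that], of "\<bar>c\<bar>"] abs_triangle_ineq[of "f x" "c * g x"]
    by (simp add: abs_mult)
  moreover have "coord_lipschitz (\<lambda>j. L j + \<bar>c\<bar> * L' j) (\<lambda>x. f x + c * g x)"
    unfolding coord_lipschitz_def
  proof (intro ballI impI)
    fix j x y assume *: "j \<in> T" "x \<in> space \<mu>" "y \<in> space \<mu>" "\<forall>k\<in>T - {j}. x k = y k"
    have lf: "\<bar>f x - f y\<bar> \<le> L j * d (x j) (y j)" and lg: "\<bar>g x - g y\<bar> \<le> L' j * d (x j) (y j)"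
      using L * by (auto simp: coord_lipschitz_def)
    have "f x + c * g x - (f y + c * g y) = (f x - f y) + c * (g x - g y)" by (simp add: algebra_simps)
    then have "\<bar>f x + c * g x - (f y + c * g y)\<bar> \<le> \<bar>f x - f y\<bar> + \<bar>c\<bar> * \<bar>g x - g y\<bar>"
      using abs_triangle_ineq[of "f x - f y" "c * (g x - g y)"] by (simp add: abs_mult)
    also have "\<dots> \<le> L j * d (x j) (y j) + \<bar>c\<bar> * (L' j * d (x j) (y j))"
      using lf lg by (intro add_mono mult_left_mono) auto
    finally show "\<bar>f x + c * g x - (f y + c * g y)\<bar> \<le> (L j + \<bar>c\<bar> * L' j) * d (x j) (y j)"
      by (simp add: algebra_simps)
  qed
  ultimately show ?thesis
    using m unfolding lipschitz_functions_def bounded_measurable_def by auto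
qed

section \<open>Closure properties of the approximable functions\<close>

lemma integral_square_add_le:
  assumes u: "u \<in> L2" and v: "v \<in> L2"
  shows "(\<integral>x. (u x + v x)\<^sup>2 \<partial>\<mu>) \<le> 2 * (\<integral>x. (u x)\<^sup>2 \<partial>\<mu>) + 2 * (\<integral>x. (v x)\<^sup>2 \<partial>\<mu>)"
proof -
  have i: "integrable \<mu> (\<lambda>x. (u x)\<^sup>2)" "integrable \<mu> (\<lambda>x. (v x)\<^sup>2)" "integrable \<mu> (\<lambda>x. (u x + v x)\<^sup>2)"
    using u v L2_lincomb[OF u v, of 1] by (auto simp: square_integrable_def)
  have "(\<integral>x. (u x + v x)\<^sup>2 \<partial>\<mu>) \<le> (\<integral>x. 2 * (u x)\<^sup>2 + 2 * (v x)\<^sup>2 \<partial>\<mu>)"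
  proof (rule integral_mono)
    fix x
    have "2 * (u x)\<^sup>2 + 2 * (v x)\<^sup>2 - (u x + v x)\<^sup>2 = (u x - v x)\<^sup>2"
      by (simp add: power2_eq_square algebra_simps)
    then show "(u x + v x)\<^sup>2 \<le> 2 * (u x)\<^sup>2 + 2 * (v x)\<^sup>2"
      using zero_le_power2[of "u x - v x"] by linarith
  qed (use i in auto)
  then show ?thesis using i by simp
qed

lemma approximable_lincomb:
  assumes f: "f \<in> L2" "approximable f" and g: "g \<in> L2" "approximable g"
  shows "approximable (\<lambda>x. f x + c * g x)"
  unfolding approximable_def
proof (intro allI impI)
  fix e :: real assume e: "0 < e"
  \<comment> \<open>The two errors enter with weights 2 and 2 c^2; the 3 in place of 2 leaves a
    strict margin.\<close>
  define e' where "e' = e / (3 + 2 * c\<^sup>2)"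
  have pos: "0 < 3 + 2 * c\<^sup>2" using zero_le_power2[of c] by linarith
  then have e': "0 < e'" "(3 + 2 * c\<^sup>2) * e' = e" using e by (auto simp: e'_def)
  obtain h where h: "h \<in> lipschitz_functions" "(\<integral>x. (f x - h x)\<^sup>2 \<partial>\<mu>) < e'"
    using f(2) e'(1) unfolding approximable_def by blast
  obtain k where k: "k \<in> lipschitz_functions" "(\<integral>x. (g x - k x)\<^sup>2 \<partial>\<mu>) < e'"
    using g(2) e'(1) unfolding approximable_def by blast
  have u: "(\<lambda>x. f x - h x) \<in> L2" and v: "(\<lambda>x. g x - k x) \<in> L2"
    using cov.diff_closed f(1) g(1) h(1) k(1) lipschitz_functions_L2 by auto
  have "(\<lambda>x. 0 + c * (g x - k x)) \<in> L2"
    by (rule L2_lincomb[OF L2_bounded[of "\<lambda>_. 0" 0] v]) auto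
  then have cv: "(\<lambda>x. c * (g x - k x)) \<in> L2" by simp
  have "(\<integral>x. (f x + c * g x - (h x + c * k x))\<^sup>2 \<partial>\<mu>) = (\<integral>x. ((f x - h x) + c * (g x - k x))\<^sup>2 \<partial>\<mu>)"
    by (intro Bochner_Integration.integral_cong) (simp_all add: algebra_simps)
  also have "\<dots> \<le> 2 * (\<integral>x. (f x - h x)\<^sup>2 \<partial>\<mu>) + 2 * (\<integral>x. (c * (g x - k x))\<^sup>2 \<partial>\<mu>)"
    by (rule integral_square_add_le[OF u cv])
  also have "\<dots> = 2 * (\<integral>x. (f x - h x)\<^sup>2 \<partial>\<mu>) + 2 * c\<^sup>2 * (\<integral>x. (g x - k x)\<^sup>2 \<partial>\<mu>)"
    by (simp add: power_mult_distrib)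
  also have "\<dots> \<le> 2 * e' + 2 * c\<^sup>2 * e'"
    using h(2) k(2) by (intro add_mono mult_left_mono) auto
  also have "\<dots> < (3 + 2 * c\<^sup>2) * e'" using e'(1) by (simp add: algebra_simps)
  finally have "(\<integral>x. (f x + c * g x - (h x + c * k x))\<^sup>2 \<partial>\<mu>) < e" using e'(2) by simp
  then show "\<exists>h\<in>lipschitz_functions. (\<integral>x. (f x + c * g x - h x)\<^sup>2 \<partial>\<mu>) < e"
    using lipschitz_functions_lincomb[OF h(1) k(1), of c] by (intro bexI)
qed

text \<open>Dominated convergence, with 4 w^2 dominating because both f and \<open>F n\<close> are
  bounded by w. Two errors below e/4, each doubled, add up to less than e.\<close>

lemma approximable_limit:
  assumes F: "\<And>n. F n \<in> L2" "\<And>n. approximable (F n)" and f: "f \<in> L2" and w: "w \<in> L2"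
    and lim: "\<And>x. x \<in> space \<mu> \<Longrightarrow> (\<lambda>n. F n x) \<longlonglongrightarrow> f x"
    and dom: "\<And>n x. x \<in> space \<mu> \<Longrightarrow> \<bar>F n x\<bar> \<le> w x"
  shows "approximable f"
  unfolding approximable_def
proof (intro allI impI)
  fix e :: real assume e: "0 < e"
  have fw: "\<bar>f x\<bar> \<le> w x" if "x \<in> space \<mu>" for x
    using LIMSEQ_le_const2[OF tendsto_rabs[OF lim[OF that]]] dom[OF that] by blast
  have "(\<lambda>n. \<integral>x. (f x - F n x)\<^sup>2 \<partial>\<mu>) \<longlonglongrightarrow> (\<integral>x. 0 \<partial>\<mu>)"
  proof (rule integral_dominated_convergence[where w = "\<lambda>x. 4 * (w x)\<^sup>2"])
    show "AE x in \<mu>. (\<lambda>n. (f x - F n x)\<^sup>2) \<longlonglongrightarrow> 0"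
    proof (rule AE_I2)
      fix x assume "x \<in> space \<mu>"
      from tendsto_power[OF tendsto_diff[OF tendsto_const[of "f x"] lim[OF this]], of 2]
      show "(\<lambda>n. (f x - F n x)\<^sup>2) \<longlonglongrightarrow> 0" by simp
    qed
    show "AE x in \<mu>. norm ((f x - F n x)\<^sup>2) \<le> 4 * (w x)\<^sup>2" for n
    proof (rule AE_I2)
      fix x assume x: "x \<in> space \<mu>"
      have "\<bar>f x - F n x\<bar> \<le> 2 * w x" using fw[OF x] dom[OF x, of n] by linarith
      then have "\<bar>f x - F n x\<bar>\<^sup>2 \<le> (2 * w x)\<^sup>2" by (rule power_mono) simp
      then show "norm ((f x - F n x)\<^sup>2) \<le> 4 * (w x)\<^sup>2" by simp
    qed
    show "(\<lambda>x. (f x - F n x)\<^sup>2) \<in> borel_measurable \<mu>" for n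
      using f F(1)[of n] by (auto simp: L2_iff intro!: borel_measurable_power borel_measurable_diff)
  qed (use w in \<open>auto simp: square_integrable_def\<close>)
  then have "\<forall>\<^sub>F n in sequentially. (\<integral>x. (f x - F n x)\<^sup>2 \<partial>\<mu>) < e / 4"
    using e by (intro order_tendstoD) auto
  then obtain n where n: "(\<integral>x. (f x - F n x)\<^sup>2 \<partial>\<mu>) < e / 4"
    by (auto simp: eventually_sequentially)
  obtain h where h: "h \<in> lipschitz_functions" "(\<integral>x. (F n x - h x)\<^sup>2 \<partial>\<mu>) < e / 4"
    using F(2)[of n] e unfolding approximable_def by (meson divide_pos_pos zero_less_numeral)
  have u: "(\<lambda>x. f x - F n x) \<in> L2" and v: "(\<lambda>x. F n x - h x) \<in> L2"
    using cov.diff_closed f F(1) h(1) lipschitz_functions_L2 by auto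
  have "(\<integral>x. (f x - h x)\<^sup>2 \<partial>\<mu>) = (\<integral>x. ((f x - F n x) + (F n x - h x))\<^sup>2 \<partial>\<mu>)" by simp
  also have "\<dots> \<le> 2 * (\<integral>x. (f x - F n x)\<^sup>2 \<partial>\<mu>) + 2 * (\<integral>x. (F n x - h x)\<^sup>2 \<partial>\<mu>)"
    by (rule integral_square_add_le[OF u v])
  also have "\<dots> < e" using n h(2) by linarith
  finally show "\<exists>h\<in>lipschitz_functions. (\<integral>x. (f x - h x)\<^sup>2 \<partial>\<mu>) < e" using h(1) by blast
qed

lemma indicator_L2:
  assumes "A \<in> sets \<mu>"
  shows "(indicator A :: ('i \<Rightarrow> 'e) \<Rightarrow> real) \<in> L2"
  using assms by (intro L2_bounded[of _ 1]) (auto simp: indicator_def)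

lemma product_lipschitz_functions:
  fixes h :: "'i \<Rightarrow> 'e \<Rightarrow> real"
  assumes m: "\<And>i. i \<in> T \<Longrightarrow> h i \<in> borel_measurable B"
    and b: "\<And>i z. i \<in> T \<Longrightarrow> z \<in> space B \<Longrightarrow> 0 \<le> h i z \<and> h i z \<le> 1"
    and l: "\<And>i z w. i \<in> T \<Longrightarrow> z \<in> space B \<Longrightarrow> w \<in> space B \<Longrightarrow> \<bar>h i z - h i w\<bar> \<le> l i * d z w"
  shows "(\<lambda>x. \<Prod>i\<in>T. h i (x i)) \<in> lipschitz_functions"
proof -
  have "(\<lambda>x. h i (x i)) \<in> borel_measurable \<mu>" if "i \<in> T" for i
  proof -
    have "(\<lambda>x. x i) \<in> \<mu> \<rightarrow>\<^sub>M B"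
      using measurable_component_singleton[OF that, of "\<lambda>_. B"] by (simp cong: measurable_cong_sets add: sets_mu)
    from measurable_compose[OF this m[OF that]] show ?thesis .
  qed
  then have meas: "(\<lambda>x. \<Prod>i\<in>T. h i (x i)) \<in> borel_measurable \<mu>" by (intro borel_measurable_prod) auto
  have prod01: "0 \<le> (\<Prod>i\<in>S. h i (x i)) \<and> (\<Prod>i\<in>S. h i (x i)) \<le> 1" if "x \<in> space \<mu>" "S \<subseteq> T" for x S
    using b coord_in_space[OF that(1)] that(2) by (intro conjI prod_nonneg prod_le_1) auto
  have "coord_lipschitz l (\<lambda>x. \<Prod>i\<in>T. h i (x i))"
    unfolding coord_lipschitz_def
  proof (intro ballI impI)
    fix j x y assume j: "j \<in> T" and x: "x \<in> space \<mu>" and y: "y \<in> space \<mu>"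
      and off: "\<forall>k\<in>T - {j}. x k = y k"
    let ?P = "\<Prod>i\<in>T - {j}. h i (x i)"
    \<comment> \<open>A change at j alone leaves the other factors in common, and their product is
      at most 1.\<close>
    have "(\<Prod>i\<in>T - {j}. h i (y i)) = ?P" using off by (intro prod.cong) auto
    then have "(\<Prod>i\<in>T. h i (x i)) - (\<Prod>i\<in>T. h i (y i)) = (h j (x j) - h j (y j)) * ?P"
      using prod.remove[OF finite_T j, of "\<lambda>i. h i (x i)"] prod.remove[OF finite_T j, of "\<lambda>i. h i (y i)"]
      by (simp add: algebra_simps)
    moreover have "\<bar>h j (x j) - h j (y j)\<bar> * \<bar>?P\<bar> \<le> \<bar>h j (x j) - h j (y j)\<bar> * 1"
      using prod01[OF x, of "T - {j}"] by (intro mult_left_mono) auto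
    moreover have "\<bar>h j (x j) - h j (y j)\<bar> \<le> l j * d (x j) (y j)"
      using l[OF j coord_in_space[OF x j] coord_in_space[OF y j]] .
    ultimately show "\<bar>(\<Prod>i\<in>T. h i (x i)) - (\<Prod>i\<in>T. h i (y i))\<bar> \<le> l j * d (x j) (y j)"
      by (simp add: abs_mult)
  qed
  moreover have "\<bar>\<Prod>i\<in>T. h i (x i)\<bar> \<le> 1" if "x \<in> space \<mu>" for x using prod01[OF that, of T] by simp
  ultimately show ?thesis
    using meas unfolding lipschitz_functions_def bounded_measurable_def by blast
qed

lemma approximable_rectangle:
  assumes F: "\<And>i. i \<in> T \<Longrightarrow> \<exists>h. lipschitz_approximation B d (F i) h"
    and R: "R = {x \<in> space \<mu>. \<forall>i\<in>T. x i \<in> F i}" "R \<in> sets \<mu>"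
  shows "approximable (indicator R)"
proof -
  have "\<forall>i\<in>T. \<exists>h. lipschitz_approximation B d (F i) h" using F by blast
  from bchoice[OF this] obtain h where h: "\<forall>i\<in>T. lipschitz_approximation B d (F i) (h i)" by blast
  have m: "h i n \<in> borel_measurable B"
    and b: "z \<in> space B \<Longrightarrow> 0 \<le> h i n z \<and> h i n z \<le> 1"
    and l: "\<exists>l. \<forall>z\<in>space B. \<forall>w\<in>space B. \<bar>h i n z - h i n w\<bar> \<le> l * d z w"
    and lim: "z \<in> space B \<Longrightarrow> (\<lambda>n. h i n z) \<longlonglongrightarrow> indicator (F i) z" if "i \<in> T" for i n z
    using h[rule_format, OF that] by (auto simp: lipschitz_approximation_def)
  define g where "g n x = (\<Prod>i\<in>T. h i n (x i))" for n x
  have g: "g n \<in> lipschitz_functions" for n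
  proof -
    have "\<forall>i\<in>T. \<exists>l. \<forall>z\<in>space B. \<forall>w\<in>space B. \<bar>h i n z - h i n w\<bar> \<le> l * d z w" using l by blast
    from bchoice[OF this] obtain c
      where "\<forall>i\<in>T. \<forall>z\<in>space B. \<forall>w\<in>space B. \<bar>h i n z - h i n w\<bar> \<le> c i * d z w" by blast
    then show ?thesis unfolding g_def[abs_def]
      using m b by (intro product_lipschitz_functions[where l = c]) auto
  qed
  show ?thesis
  proof (rule approximable_limit[where F = g and w = "\<lambda>_. 1"])
    show "g n \<in> L2" "approximable (g n)" for n
      using g lipschitz_functions_L2 lipschitz_functions_approximable by auto
    show "indicator R \<in> L2" by (rule indicator_L2[OF R(2)])
    show "(\<lambda>_. 1) \<in> L2" by (rule L2_bounded[of _ 1]) auto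
    fix x assume x: "x \<in> space \<mu>"
    have "(\<lambda>n. g n x) \<longlonglongrightarrow> (\<Prod>i\<in>T. indicator (F i) (x i))"
      unfolding g_def using lim coord_in_space[OF x] by (intro tendsto_prod) auto
    also have "(\<Prod>i\<in>T. indicator (F i) (x i)) = (indicator R x :: real)"
      using x finite_T by (auto simp: R(1) indicator_def prod_zero_iff)
    finally show "(\<lambda>n. g n x) \<longlonglongrightarrow> indicator R x" .
    show "\<bar>g n x\<bar> \<le> 1" for n
      using b coord_in_space[OF x] unfolding g_def by (auto simp: abs_prod intro!: prod_le_1)
  qed
qed

text \<open>Dynkin's argument: rectangles over G form an intersection-stable generator, complements
  are handled by linearity and disjoint unions by bounded limits.\<close>

lemma approximable_indicator:
  assumes G: "lipschitz_generator B d G" and A: "A \<in> sets \<mu>"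
  shows "approximable (indicator A)"
proof -
  let ?\<Omega> = "space \<mu>"
  let ?E = "{{x \<in> ?\<Omega>. \<forall>i\<in>T. x i \<in> F i} | F. \<forall>i\<in>T. F i \<in> G}"
  have sets_E: "sets \<mu> = sigma_sets ?\<Omega> ?E"
    unfolding sets_mu space_mu using G
    by (intro sets_PiM_rectangles finite_T) (auto simp: lipschitz_generator_def)
  have "Int_stable ?E"
  proof (rule Int_stableI)
    fix a b assume "a \<in> ?E" "b \<in> ?E"
    then obtain F F' where F: "a = {x \<in> ?\<Omega>. \<forall>i\<in>T. x i \<in> F i}" "\<forall>i\<in>T. F i \<in> G"
      and F': "b = {x \<in> ?\<Omega>. \<forall>i\<in>T. x i \<in> F' i}" "\<forall>i\<in>T. F' i \<in> G"
      by blast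
    have "a \<inter> b = {x \<in> ?\<Omega>. \<forall>i\<in>T. x i \<in> F i \<inter> F' i}" using F F' by blast
    moreover have "\<forall>i\<in>T. F i \<inter> F' i \<in> G"
      using G F F' by (auto simp: lipschitz_generator_def Int_stable_def)
    ultimately show "a \<inter> b \<in> ?E" by (intro CollectI exI[of _ "\<lambda>i. F i \<inter> F' i"] conjI)
  qed
  moreover have "?E \<subseteq> Pow ?\<Omega>" by auto
  moreover have "A \<in> sigma_sets ?\<Omega> ?E" using A sets_E by simp
  ultimately show ?thesis
  proof (induction rule: sigma_sets_induct_disjoint)
    case (basic A)
    then obtain F where F: "A = {x \<in> ?\<Omega>. \<forall>i\<in>T. x i \<in> F i}" "\<forall>i\<in>T. F i \<in> G" by blast
    have "A \<in> sets \<mu>" unfolding sets_E using basic by (rule sigma_sets.Basic)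
    with F show ?case
      using G by (intro approximable_rectangle[of F]) (auto simp: lipschitz_generator_def)
  next
    case empty
    have "(indicator {} :: ('i \<Rightarrow> 'e) \<Rightarrow> real) = (\<lambda>_. 0)" by (simp add: fun_eq_iff)
    then show ?case using lipschitz_functions_approximable[OF lipschitz_functions_const[of 0]] by simp
  next
    case (compl A)
    have A: "A \<in> sets \<mu>" using compl sets_E by simp
    have 1: "(\<lambda>_. 1) \<in> L2" "approximable (\<lambda>_. 1)"
      using lipschitz_functions_const lipschitz_functions_L2 lipschitz_functions_approximable by auto
    have "approximable (\<lambda>x. 1 + (- 1) * indicator A x)"
      by (rule approximable_lincomb[OF 1 indicator_L2[OF A] compl(2)])
    \<comment> \<open>The two functions agree only on the space of \<mu>, so the integrals are
      compared rather than the functions.\<close>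
    moreover have "(\<integral>x. (1 + (- 1) * indicator A x - h x)\<^sup>2 \<partial>\<mu>) = (\<integral>x. (indicator (?\<Omega> - A) x - h x)\<^sup>2 \<partial>\<mu>)"
      for h :: "('i \<Rightarrow> 'e) \<Rightarrow> real"
      by (intro Bochner_Integration.integral_cong) (auto simp: indicator_def)
    ultimately show ?case unfolding approximable_def by simp
  next
    case (union A)
    have A: "A i \<in> sets \<mu>" for i using union(2) sets_E by auto
    define S where "S n x = (\<Sum>i<n. indicator (A i) x :: real)" for n x
    have S_L2: "S n \<in> L2" for n
      unfolding S_def[abs_def] by (intro L2_sum indicator_L2[OF A]) auto
    \<comment> \<open>By disjointness the partial sums are indicators, hence bounded by 1 uniformly
      in n.\<close>
    have S_ind: "S n x = indicator (\<Union>i<n. A i) x" for n x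
      unfolding S_def using union(1)
      by (subst indicator_UN_disjoint) (auto simp: disjoint_family_on_def)
    show ?case
    proof (rule approximable_limit[where F = S and w = "\<lambda>_. 1"])
      show "S n \<in> L2" for n by (rule S_L2)
      show "approximable (S n)" for n
      proof (induction n)
        case 0
        show ?case
          using lipschitz_functions_approximable[OF lipschitz_functions_const[of 0]] by (simp add: S_def[abs_def])
      next
        case (Suc n)
        from approximable_lincomb[OF S_L2 Suc indicator_L2[OF A] union(3), of 1 n]
        show ?case by (simp add: S_def[abs_def])
      qed
      show "indicator (\<Union>i. A i) \<in> L2" using A by (intro indicator_L2) auto
      show "(\<lambda>_. 1) \<in> L2" by (rule L2_bounded[of _ 1]) auto
      show "(\<lambda>n. S n x) \<longlonglongrightarrow> indicator (\<Union>i. A i) x" for x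
        unfolding S_ind by (rule LIMSEQ_indicator_UN)
      show "\<bar>S n x\<bar> \<le> 1" for n x unfolding S_ind by (simp add: indicator_def)
    qed
  qed
qed

text \<open>Induction over simple functions and monotone limits carries membership in L2 along, so
  in each case it has to be recovered for the pieces before the induction hypothesis
  applies.\<close>

lemma approximable_nonneg:
  assumes G: "lipschitz_generator B d G"
    and u: "u \<in> borel_measurable \<mu>" "\<And>x. 0 \<le> u x" "u \<in> L2"
  shows "approximable u"
  using u
proof (induction rule: borel_measurable_induct_real)
  case (set A)
  then show ?case using approximable_indicator[OF G] by simp
next
  case (mult u c)
  show ?case
  \<comment> \<open>For c = 0 the product lies in L2 whatever u is, so nothing can be inferred about
    u; otherwise one divides by c.\<close>
  proof (cases "c = 0")
    case True
    then show ?thesis using lipschitz_functions_approximable[OF lipschitz_functions_const[of 0]] by simp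
  next
    case False
    have 0: "(\<lambda>_. 0) \<in> L2" "approximable (\<lambda>_. 0)"
      using lipschitz_functions_const lipschitz_functions_L2 lipschitz_functions_approximable by auto
    have "u \<in> L2" using L2_lincomb[OF 0(1) mult.prems, of "1 / c"] False by simp
    then show ?thesis using approximable_lincomb[OF 0, of u c] mult.IH by simp
  qed
next
  case (add u v)
  have "v \<in> L2" "u \<in> L2"
  proof -
    have i: "integrable \<mu> (\<lambda>x. (v x + u x)\<^sup>2)" using add.prems by (simp add: square_integrable_def)
    \<comment> \<open>Both summands are nonnegative, so neither square exceeds that of the
      sum.\<close>
    have "(v x)\<^sup>2 \<le> (v x + u x)\<^sup>2" "(u x)\<^sup>2 \<le> (v x + u x)\<^sup>2" for x
      using add.hyps by (auto intro!: power_mono)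
    then show "v \<in> L2" "u \<in> L2"
      using add.hyps by (auto simp: square_integrable_def intro!: Bochner_Integration.integrable_bound[OF i])
  qed
  then show ?case using approximable_lincomb[of v u 1] add.IH by simp
next
  case (seq U)
  have le: "U n x \<le> u x" if "x \<in> space \<mu>" for n x
    using seq.hyps(4)[OF that] seq.hyps(3) by (intro incseq_le) (auto simp: incseq_def le_fun_def)
  have i: "integrable \<mu> (\<lambda>x. (u x)\<^sup>2)" using seq.prems by (simp add: square_integrable_def)
  have UL: "U n \<in> L2" for n
    using seq.hyps(1)[of n] le[of _ n] seq.hyps(2)[of n]
    by (auto simp: square_integrable_def intro!: Bochner_Integration.integrable_bound[OF i] power_mono AE_I2)
  show ?case
    by (rule approximable_limit[OF UL seq.IH[OF UL] seq.prems seq.prems seq.hyps(4)])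
      (use le seq.hyps(2) in auto)
qed

lemma lipschitz_functions_dense:
  assumes G: "lipschitz_generator B d G" and f: "f \<in> L2"
  shows "approximable f"
proof -
  define p where "p x = max (f x) 0" for x
  define q where "q x = max (- f x) 0" for x
  have fm: "f \<in> borel_measurable \<mu>" and i: "integrable \<mu> (\<lambda>x. (f x)\<^sup>2)"
    using f by (auto simp: square_integrable_def)
  have pq: "p \<in> L2" "q \<in> L2"
    using fm unfolding p_def q_def square_integrable_def
    by (auto intro!: Bochner_Integration.integrable_bound[OF i] AE_I2 simp: max_def)
  have "approximable p" "approximable q"
    using pq by (auto intro!: approximable_nonneg[OF G] simp: p_def q_def L2_iff)
  from approximable_lincomb[OF pq(1) this(1) pq(2) this(2), of "-1"]
  have "approximable (\<lambda>x. p x - q x)" by simp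
  moreover have "(\<lambda>x. p x - q x) = f" by (auto simp: fun_eq_iff p_def q_def max_def)
  ultimately show ?thesis by simp
qed

section \<open>Contraction on all of L2 and the Poincare inequality\<close>

lemma covariance_sweep_le_contraction:
  assumes G: "lipschitz_generator B d G" and y: "y \<in> space \<mu>"
    and moment: "\<And>j. j \<in> T \<Longrightarrow> (\<integral>\<^sup>+x. ennreal ((d (x j) (y j))\<^sup>2) \<partial>\<mu>) < \<infinity>"
    and v: "\<And>j. j \<in> T \<Longrightarrow> 0 < v j" and sub: "\<And>j. j \<in> T \<Longrightarrow> (\<Sum>i\<in>T. v i * coeff i j) \<le> s * v j"
    and s: "0 < s" and f: "f \<in> L2"
  shows "covariance \<mu> (sweep f) f \<le> (1 - (1 - s) / card T) * covariance \<mu> f f"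
proof (rule cov.ip_image_le_of_dense[where D = lipschitz_functions])
  show "lipschitz_functions \<subseteq> L2" by (rule lipschitz_functions_L2)
  show "\<exists>h\<in>lipschitz_functions. covariance \<mu> (\<lambda>x. f x - h x) (\<lambda>x. f x - h x) < e" if e: "0 < e" for e
  proof -
    obtain h where h: "h \<in> lipschitz_functions" "(\<integral>x. (f x - h x)\<^sup>2 \<partial>\<mu>) < e"
      using lipschitz_functions_dense[OF G f] e unfolding approximable_def by blast
    have "(\<lambda>x. f x - h x) \<in> L2" using cov.diff_closed f h(1) lipschitz_functions_L2 by auto
    from covariance_le_second_moment[OF this, of 0] h show ?thesis by (intro bexI[of _ h]) auto
  qed
next
  fix h assume h: "h \<in> lipschitz_functions"
  then obtain L where bm: "bounded_measurable h" and L: "coord_lipschitz L h"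
    by (auto simp: lipschitz_functions_def)
  \<comment> \<open>Large enough that the profile a v dominates every \<open>L j\<close>, which is
    possible because v is strictly positive; the summand 1 keeps a positive.\<close>
  define a where "a = 1 + (\<Sum>j\<in>T. \<bar>L j\<bar> / v j)"
  have nn: "0 \<le> \<bar>L j\<bar> / v j" if "j \<in> T" for j using v[OF that] by simp
  have a: "0 < a" unfolding a_def using sum_nonneg[of T "\<lambda>j. \<bar>L j\<bar> / v j"] nn by force
  have La: "L j \<le> a * v j" if j: "j \<in> T" for j
  proof -
    have "\<bar>L j\<bar> / v j \<le> a"
      unfolding a_def by (intro add_increasing member_le_sum[OF j] finite_T nn) auto
    then have "\<bar>L j\<bar> \<le> a * v j" using v[OF j] by (simp add: field_simps)
    then show ?thesis by simp
  qed
  have lip: "coord_lipschitz (\<lambda>j. a * v j) h"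
    unfolding coord_lipschitz_def
  proof (intro ballI impI)
    fix j x z assume j: "j \<in> T" and x: "x \<in> space \<mu>" and z: "z \<in> space \<mu>"
      and off: "\<forall>k\<in>T - {j}. x k = z k"
    have "\<bar>h x - h z\<bar> \<le> L j * d (x j) (z j)" using off by (intro coord_lipschitzD[OF L j x z]) auto
    also have "\<dots> \<le> a * v j * d (x j) (z j)"
      using La[OF j] d_nonneg coord_in_space x z j by (intro mult_right_mono) auto
    finally show "\<bar>h x - h z\<bar> \<le> a * v j * d (x j) (z j)" .
  qed
  have "1 \<le> real (card T)" using card_T_pos by simp
  then have \<theta>: "0 \<le> 1 - (1 - s) / card T" using s card_T_pos by (simp add: field_simps)
  show "covariance \<mu> (sweep h) h \<le> (1 - (1 - s) / card T) * covariance \<mu> h h"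
  proof (rule cov.ip_image_le_of_decay[OF sweep_L2 covariance_sweep_sym])
    show "h \<in> L2" using h lipschitz_functions_L2 by auto
    show "covariance \<mu> ((sweep ^^ k) h) ((sweep ^^ k) h)
        \<le> (a\<^sup>2 * (\<integral>x. (\<Sum>j\<in>T. v j * d (x j) (y j))\<^sup>2 \<partial>\<mu>)) * ((1 - (1 - s) / card T)\<^sup>2) ^ k" for k
      by (rule sweep_iterate_decay[OF bm lip a v sub s y moment])
  qed (assumption | rule \<theta>)+
qed (use f sweep_L2 covariance_sweep_sym covariance_sweep_le in blast)+

lemma poincare_inequality:
  assumes G: "lipschitz_generator B d G" and y: "y \<in> space \<mu>"
    and moment: "\<And>j. j \<in> T \<Longrightarrow> (\<integral>\<^sup>+x. ennreal ((d (x j) (y j))\<^sup>2) \<partial>\<mu>) < \<infinity>"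
    and r: "spectral_radius_on T coeff < 1" and f: "f \<in> L2"
  shows "(1 - spectral_radius_on T coeff) * covariance \<mu> f f \<le> dirichlet_form T \<mu> K f"
proof -
  let ?r = "spectral_radius_on T coeff" and ?X = "covariance \<mu> f f" and ?E = "dirichlet_form T \<mu> K f"
  have r0: "0 \<le> ?r" by (rule spectral_radius_on_nonneg[OF finite_T T_nonempty])
  have le: "(1 - s) * ?X \<le> ?E" if s: "?r < s" "s < 1" for s
  proof -
    have "\<exists>v. (\<forall>i\<in>T. 0 < v i) \<and> (\<forall>j\<in>T. (\<Sum>i\<in>T. v i * coeff i j) \<le> s * v j)"
      by (rule exists_subinvariant_vector[OF finite_T T_nonempty _ s(1)]) simp
    then obtain v where v: "\<And>j. j \<in> T \<Longrightarrow> 0 < v j"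
        "\<And>j. j \<in> T \<Longrightarrow> (\<Sum>i\<in>T. v i * coeff i j) \<le> s * v j" by blast
    have "0 < s" using s r0 by simp
    from covariance_sweep_le_contraction[OF G y moment v this f]
    have "?X - (1 - (1 - s) / card T) * ?X \<le> ?X - covariance \<mu> (sweep f) f" by simp
    then have "card T * (?X - (1 - (1 - s) / card T) * ?X) \<le> ?E"
      unfolding dirichlet_form_eq_covariance[OF f] using card_T_pos by (intro mult_left_mono) auto
    \<comment> \<open>n (1 - \<theta>) = 1 - s: the number of sites disappears from the final
      constant.\<close>
    moreover have "card T * (?X - (1 - (1 - s) / card T) * ?X) = (1 - s) * ?X"
      using card_T_pos by (simp add: field_simps)
    ultimately show ?thesis by simp
  qed
  show ?thesis
  proof (cases "?X = 0")
    case True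
    then show ?thesis using le[of "(?r + 1) / 2"] r by simp
  next
    case False
    then have X: "0 < ?X" using cov.ip_nonneg[OF f] by simp
    \<comment> \<open>Dividing by the positive variance isolates s, so s can decrease to the radius
      by density of the order.\<close>
    have "1 - ?E / ?X \<le> ?r"
    proof (rule dense_ge_bounded[OF r])
      fix s assume "?r < s" "s < 1"
      from le[OF this] X show "1 - ?E / ?X \<le> s" by (simp add: field_simps)
    qed
    then show ?thesis using X by (simp add: field_simps)
  qed
qed

end

section \<open>State spaces\<close>

context Metric_space
begin

text \<open>This makes Lipschitz functions, in particular distances to a point, Borel
  measurable.\<close>

lemma openin_less_lipschitz:
  fixes g :: "'a \<Rightarrow> real"
  assumes g: "\<And>z w. z \<in> M \<Longrightarrow> w \<in> M \<Longrightarrow> \<bar>g z - g w\<bar> \<le> l * d z w"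
  shows "openin mtopology {z \<in> M. g z < c}"
  unfolding openin_mtopology
proof (intro conjI allI impI)
  fix z assume z: "z \<in> {z \<in> M. g z < c}"
  \<comment> \<open>The denominator is positive for every l, including zero and negative
    values.\<close>
  define r where "r = (c - g z) / (\<bar>l\<bar> + 1)"
  have r: "0 < r" "(\<bar>l\<bar> + 1) * r = c - g z" using z by (auto simp: r_def)
  have "mball z r \<subseteq> {z \<in> M. g z < c}"
  proof
    fix w assume w: "w \<in> mball z r"
    have "\<bar>g z - g w\<bar> \<le> l * d z w" using g w by simp
    also have "\<dots> \<le> (\<bar>l\<bar> + 1) * d z w" by (intro mult_right_mono) auto
    also have "\<dots> < (\<bar>l\<bar> + 1) * r" using w by (intro mult_strict_left_mono) auto
    finally show "w \<in> {z \<in> M. g z < c}" using r(2) w by auto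
  qed
  then show "\<exists>r>0. mball z r \<subseteq> {z \<in> M. g z < c}" using r(1) by blast
qed auto

text \<open>The witness is the regularization \<open>z \<mapsto> inf\<^sub>w (1\<^sub>U w + n d z w)\<close> of \<open>1\<^sub>U\<close>.\<close>

lemma open_indicator_lipschitz_limit:
  assumes U: "openin mtopology U"
  obtains h :: "nat \<Rightarrow> 'a \<Rightarrow> real" where "\<And>n z. z \<in> M \<Longrightarrow> 0 \<le> h n z \<and> h n z \<le> 1"
    and "\<And>n z w. z \<in> M \<Longrightarrow> w \<in> M \<Longrightarrow> \<bar>h n z - h n w\<bar> \<le> real n * d z w"
    and "\<And>z. z \<in> M \<Longrightarrow> (\<lambda>n. h n z) \<longlonglongrightarrow> indicator U z"
proof -
  define \<phi> where "\<phi> n z w = indicator U w + real n * d z w" for n z w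
  define h where "h n z = (INF w\<in>M. \<phi> n z w)" for n z
  have \<phi>_nonneg: "0 \<le> \<phi> n z w" for n z w by (simp add: \<phi>_def indicator_def)
  have lower: "h n z \<le> \<phi> n z w" if "w \<in> M" for n z w
    unfolding h_def using that \<phi>_nonneg by (intro cINF_lower) (auto intro!: bdd_belowI2[of _ 0])
  have greatest: "c \<le> h n z" if "z \<in> M" "\<And>w. w \<in> M \<Longrightarrow> c \<le> \<phi> n z w" for c n z
    unfolding h_def using that by (intro cINF_greatest) auto
  have le_ind: "h n z \<le> indicator U z" if "z \<in> M" for n z
    using lower[OF that, of n z] that by (simp add: \<phi>_def)
  have lip: "h n z - real n * d z w \<le> h n w" if "z \<in> M" "w \<in> M" for n z w
  proof (rule greatest[OF that(2)])
    fix u assume u: "u \<in> M"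
    have "real n * d z u \<le> real n * (d z w + d w u)"
      using triangle[OF that u] by (intro mult_left_mono) auto
    then show "h n z - real n * d z w \<le> \<phi> n w u"
      using lower[OF u, of n z] by (simp add: \<phi>_def algebra_simps)
  qed
  show ?thesis
  proof (rule that[of h])
    show "0 \<le> h n z \<and> h n z \<le> 1" if "z \<in> M" for n z
      using greatest[OF that \<phi>_nonneg] order_trans[OF le_ind[OF that]] by (auto simp: indicator_def)
    show "\<bar>h n z - h n w\<bar> \<le> real n * d z w" if "z \<in> M" "w \<in> M" for n z w
      using lip[OF that, of n] lip[OF that(2,1), of n] commute[of z w] by (simp add: abs_le_iff)
    fix z assume z: "z \<in> M"
    show "(\<lambda>n. h n z) \<longlonglongrightarrow> indicator U z"
    proof (cases "z \<in> U")
      case False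
      have "h n z = 0" for n
        using greatest[OF z \<phi>_nonneg, of n] le_ind[OF z, of n] False by simp
      then show ?thesis using False by simp
    next
      case True
      then obtain r where r: "0 < r" "mball z r \<subseteq> U" using U unfolding openin_mtopology by blast
      \<comment> \<open>Points outside U are at distance at least r from z, so from N on the penalty
        there is at least 1, as much as the indicator charges inside U.\<close>
      obtain N :: nat where N: "1 / r \<le> real N" using real_arch_simple by blast
      have "h n z = 1" if n: "N \<le> n" for n
      proof (rule antisym)
        show "h n z \<le> 1" using le_ind[OF z, of n] True by simp
        show "1 \<le> h n z"
        proof (rule greatest[OF z])
          fix w assume w: "w \<in> M"
          show "1 \<le> \<phi> n z w"
          proof (cases "w \<in> U")
            case False
            then have "r \<le> d z w" using r(2) z w by (auto simp: subset_iff not_less)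
            moreover have "1 \<le> real n * r" 
            proof -
              have "1 \<le> real N * r" using N r(1) by (simp add: field_simps)
              also have "\<dots> \<le> real n * r" using n r(1) by (intro mult_right_mono) auto
              finally show ?thesis .
            qed
            ultimately have "1 \<le> real n * d z w"
              by (meson mult_left_mono of_nat_0_le_iff order_trans)
            then show ?thesis using False by (simp add: \<phi>_def)
          qed (simp add: \<phi>_def)
        qed
      qed
      then have "\<forall>\<^sub>F n in sequentially. h n z = indicator U z"
        using True by (auto simp: eventually_sequentially)
      then show ?thesis by (rule tendsto_eventually)
    qed
  qed
qed

end

lemma polish_state_space_facts:
  assumes "polish_state_space B d"
  shows "\<And>z. z \<in> space B \<Longrightarrow> d z z = 0"
    and "\<And>z w. z \<in> space B \<Longrightarrow> w \<in> space B \<Longrightarrow> z \<noteq> w \<Longrightarrow> 0 < d z w"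
    and "\<And>w. w \<in> space B \<Longrightarrow> (\<lambda>z. d z w) \<in> borel_measurable B"
    and "\<exists>G. lipschitz_generator B d G"
proof -
  interpret Metric_space "space B" d using assms by (simp add: polish_state_space_def)
  have sets_B: "sets B = sigma_sets (space B) {U. openin mtopology U}"
    using assms by (simp add: polish_state_space_def)
  have meas: "g \<in> borel_measurable B"
    if lip: "\<And>z w. z \<in> space B \<Longrightarrow> w \<in> space B \<Longrightarrow> \<bar>g z - g w\<bar> \<le> l * d z w" for g :: "'a \<Rightarrow> real" and l
  proof (rule borel_measurableI_less)
    fix c
    have "openin mtopology {z \<in> space B. g z < c}" by (rule openin_less_lipschitz[OF lip])
    then show "{z \<in> space B. g z < c} \<in> sets B" unfolding sets_B by (intro sigma_sets.Basic) simp
  qed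
  show "d z z = 0" if "z \<in> space B" for z using that by simp
  show "0 < d z w" if "z \<in> space B" "w \<in> space B" "z \<noteq> w" for z w
    using that zero[OF that(1,2)] nonneg[of z w] by linarith
  show "(\<lambda>z. d z w) \<in> borel_measurable B" if w: "w \<in> space B" for w
  proof (rule meas[of _ 1])
    fix z u assume "z \<in> space B" "u \<in> space B"
    then show "\<bar>d z w - d u w\<bar> \<le> 1 * d z u"
      using triangle[of z u w] triangle[of u z w] w commute[of z u] by linarith
  qed
  have "\<exists>h. lipschitz_approximation B d U h" if U: "openin mtopology U" for U
  proof -
    obtain h where h: "\<And>n z. z \<in> space B \<Longrightarrow> 0 \<le> h n z \<and> h n z \<le> (1::real)"
      "\<And>n z w. z \<in> space B \<Longrightarrow> w \<in> space B \<Longrightarrow> \<bar>h n z - h n w\<bar> \<le> real n * d z w"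
      "\<And>z. z \<in> space B \<Longrightarrow> (\<lambda>n. h n z) \<longlonglongrightarrow> indicator U z"
      using open_indicator_lipschitz_limit[OF U] by blast
    then have "lipschitz_approximation B d U h"
      unfolding lipschitz_approximation_def using meas[OF h(2)] by blast
    then show ?thesis by blast
  qed
  then have "lipschitz_generator B d {U. openin mtopology U}"
    unfolding lipschitz_generator_def sets_B Int_stable_def
    using openin_subset[of mtopology] openin_topspace[of mtopology] by auto
  then show "\<exists>G. lipschitz_generator B d G" ..
qed

text \<open>For the trivial metric every function with values in [0,1] is 1-Lipschitz, so the
  indicator of a measurable set approximates itself.\<close>

lemma trivial_metric_state_space_facts:
  assumes "trivial_metric_state_space B d"
  shows "\<And>z. z \<in> space B \<Longrightarrow> d z z = 0"
    and "\<And>z w. z \<in> space B \<Longrightarrow> w \<in> space B \<Longrightarrow> z \<noteq> w \<Longrightarrow> 0 < d z w"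
    and "\<And>w. w \<in> space B \<Longrightarrow> (\<lambda>z. d z w) \<in> borel_measurable B"
    and "\<exists>G. lipschitz_generator B d G"
proof -
  have d: "\<And>z w. z \<in> space B \<Longrightarrow> w \<in> space B \<Longrightarrow> d z w = (if z = w then 0 else 1)"
    and dm: "(\<lambda>(x, y). d x y) \<in> borel_measurable (B \<Otimes>\<^sub>M B)"
    using assms by (auto simp: trivial_metric_state_space_def)
  show "d z z = 0" if "z \<in> space B" for z using that d by simp
  show "0 < d z w" if "z \<in> space B" "w \<in> space B" "z \<noteq> w" for z w using that d by simp
  show "(\<lambda>z. d z w) \<in> borel_measurable B" if w: "w \<in> space B" for w
    using measurable_compose[OF measurable_Pair2'[OF w] dm] by simp
  have "lipschitz_approximation B d A (\<lambda>_. indicator A)" if "A \<in> sets B" for A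
    unfolding lipschitz_approximation_def
    using that by (auto simp: d indicator_def intro!: exI[of _ "1::real"])
  moreover have "sets B = sigma_sets (space B) (sets B)" by (simp add: sets.sigma_sets_eq)
  ultimately have "lipschitz_generator B d (sets B)"
    unfolding lipschitz_generator_def using sets.space_closed[of B] by (auto simp: Int_stable_def)
  then show "\<exists>G. lipschitz_generator B d G" ..
qed

lemma covariance_empty_sites:
  assumes "prob_space \<mu>" "sets \<mu> = sets (Pi\<^sub>M {} (\<lambda>_. B))"
  shows "covariance \<mu> f f = 0"
proof -
  interpret prob_space \<mu> by fact
  have "space \<mu> = {\<lambda>_. undefined}"
    using sets_eq_imp_space_eq[OF assms(2)] by (simp add: space_PiM)
  then have "(\<integral>x. g x \<partial>\<mu>) = g (\<lambda>_. undefined)" for g :: "_ \<Rightarrow> real"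
    using Bochner_Integration.integral_cong[of \<mu> \<mu> g "\<lambda>_. g (\<lambda>_. undefined)"] prob_space by simp
  then show ?thesis by (simp add: covariance_def)
qed

theorem theorem2p1:
  fixes T :: "'i set"
    and B :: "'e measure"
    and d :: "'e \<Rightarrow> 'e \<Rightarrow> real"
    and \<mu> :: "('i \<Rightarrow> 'e) measure"
    and K :: "'i \<Rightarrow> ('i \<Rightarrow> 'e) \<Rightarrow> 'e measure"
    and y :: "'i \<Rightarrow> 'e"
    and r :: real
  defines "r \<equiv> spectral_radius_on T (\<lambda>i j. enn2real (dobrushin_coeff T B d K i j))"
  assumes "finite T"
    and "polish_state_space B d \<or> trivial_metric_state_space B d"
    and "prob_space \<mu>"
    and "sets \<mu> = sets (Pi\<^sub>M T (\<lambda>_. B))"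
    and "\<And>i. i \<in> T \<Longrightarrow> regular_site_conditional T B \<mu> i (K i)"
    and "\<And>i j. i \<in> T \<Longrightarrow> j \<in> T \<Longrightarrow> dobrushin_coeff T B d K i j < \<infinity>"
    and "y \<in> space (Pi\<^sub>M T (\<lambda>_. B))"
    and "\<And>i. i \<in> T \<Longrightarrow> (\<integral>\<^sup>+x. ennreal ((d (x i) (y i))\<^sup>2) \<partial>\<mu>) < \<infinity>"
    and "r < 1"
  shows "(\<forall>f\<in>square_integrable \<mu>. (1 - r) * covariance \<mu> f f \<le> dirichlet_form T \<mu> K f)
    \<and> ereal (1 - r) \<le> spectral_gap T \<mu> K"
proof -
  have "(1 - r) * covariance \<mu> f f \<le> dirichlet_form T \<mu> K f" if f: "f \<in> square_integrable \<mu>" for f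
  \<comment> \<open>Without sites the product is a single point and both sides vanish, whatever the
    value of r.\<close>
  proof (cases "T = {}")
    case True
    then show ?thesis
      using covariance_empty_sites[OF assms(4), of B f] assms(5) by (simp add: dirichlet_form_def)
  next
    case False
    have d: "\<And>z. z \<in> space B \<Longrightarrow> d z z = 0"
        "\<And>z w. z \<in> space B \<Longrightarrow> w \<in> space B \<Longrightarrow> z \<noteq> w \<Longrightarrow> 0 < d z w"
        "\<And>w. w \<in> space B \<Longrightarrow> (\<lambda>z. d z w) \<in> borel_measurable B"
      and G: "\<exists>G. lipschitz_generator B d G"
      using assms(3) polish_state_space_facts[of B d] trivial_metric_state_space_facts[of B d] by blast+
    interpret prob_space \<mu> by fact
    interpret metric_gibbs_sampler \<mu> T B K d
      by unfold_locales (fact assms False d)+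
    obtain G where "lipschitz_generator B d G" using G ..
    from poincare_inequality[OF this _ assms(9) _ f] assms(8,10) show ?thesis
      by (simp add: r_def space_mu)
  qed
  \<comment> \<open>The inequality makes 1 - r, nonnegative since r < 1, one of the constants whose
    supremum is the spectral gap.\<close>
  then show ?thesis
    unfolding spectral_gap_def using assms(10) by (auto intro!: Sup_upper)
qed

end
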